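(* Let $Y$ be an arbitrary (nonnegative, absolutely continuous) random variable with a uniformly bounded hazard rate $h$, otherwise regarded as a one-dimensional $\mathrm{IPH}$-distributed random variable of parameters $(\boldsymbol{\alpha},\boldsymbol{S},h)$ with $\boldsymbol{\alpha}=(1)$ and $\boldsymbol{S}=(-1)$. Then there exists a sequence of random variables $\{Y^{(n)}\}_{n\ge\lambda_0}$ such that $Y^{(n)}\to Y$ in distribution as $n\to\infty$, and where each $Y^{(n)}$ follows an infinite-dimensional Coxian phase-type distribution with initial distribution $(1,0,0,\dots)$ and subintensity matrix $$\widetilde{\boldsymbol{S}}^{(n)}=\begin{pmatrix}-n&n\widetilde{Q}^{(n)}_1& &&\\ &-n&n\widetilde{Q}^{(n)}_2& &\\ &&-n&n\widetilde{Q}^{(n)}_3&\\ &&&\ddots&\ddots\end{pmatrix},\qquad\widetilde{Q}^{(n)}_\ell=1-\int_0^\infty\frac{(ns)^{\ell-1}}{(\ell-1)!}e^{-ns}h(s)\,\mathrm{d}s.$$ Furthermore, the density of the approximation is given by $$\tilde f_{Y^{(n)}}(y)=\sum_{\ell=1}^\infty\left((1-\widetilde{Q}^{(n)}_\ell)\prod_{m=1}^{\ell-1}\widetilde{Q}^{(n)}_m\right)\frac{y^{\ell-1}}{(\ell-1)!}n^\ell\exp(-ny),\qquad y\ge0.$$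
   Context: The hazard rate of a nonnegative random variable with density $f$ and distribution function $F$ is $h=f/(1-F)$, so that $\mathbb{P}(Y>t)=\exp(-\int_0^th(s)\,\mathrm{d}s)$. $\mathrm{IPH}(\boldsymbol{\alpha},\boldsymbol{S},h)$ denotes the law of the absorption time of a time-inhomogeneous Markov jump process with initial distribution $\boldsymbol{\alpha}$ and subintensity matrix function $h(t)\boldsymbol{S}$. Here $\lambda_0=\lceil\sup_{t\ge0}h(t)\rceil$. An infinite-dimensional phase-type distribution with given initial distribution and subintensity matrix is the law of the termination time of a time-homogeneous Markov jump process on a countable state space with that initial distribution and subintensity matrix (termination rates being minus the row sums). Empty products equal $1$. *)

theory Defs
  imports "HOL-Probability.Probability"
begin

text \<open>
  The hazard rate of a law \<open>\<mu>\<close> with density \<open>f\<close>.  Boundedness on \<open>[0, \<infinity>)\<close> forces the distribution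
  function to stay below 1, so the value 0 given to division by 0 is never attained there.
\<close>

definition hazard_rate :: "real measure \<Rightarrow> (real \<Rightarrow> real) \<Rightarrow> real \<Rightarrow> real" where
  "hazard_rate \<mu> f t = f t / (1 - cdf \<mu> t)"

definition probability_vector :: "('e \<Rightarrow> real) \<Rightarrow> bool" where
  "probability_vector \<alpha> \<longleftrightarrow> (\<forall>i. 0 \<le> \<alpha> i) \<and> (\<alpha> has_sum 1) UNIV"

definition subintensity :: "('e \<Rightarrow> 'e \<Rightarrow> real) \<Rightarrow> bool" where
  "subintensity S \<longleftrightarrow>
     (\<forall>i j. i \<noteq> j \<longrightarrow> 0 \<le> S i j) \<and> (\<forall>i. S i summable_on UNIV \<and> (\<Sum>\<^sub>\<infinity>j. S i j) \<le> 0)"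

text \<open>
  A killed process has state space \<open>'e option\<close>, with \<open>None\<close> the absorbing state.  The full intensity
  matrix completes a subintensity matrix by the termination rates (minus the row sums).
\<close>

definition full_intensity :: "('e \<Rightarrow> 'e \<Rightarrow> real) \<Rightarrow> 'e option \<Rightarrow> 'e option \<Rightarrow> real" where
  "full_intensity S x y =
     (case x of
        None \<Rightarrow> 0
      | Some i \<Rightarrow> (case y of Some j \<Rightarrow> S i j | None \<Rightarrow> - (\<Sum>\<^sub>\<infinity>j. S i j)))"

text \<open>
  \<open>P s t x y\<close> is the probability of being in \<open>y\<close> at time \<open>t\<close> given \<open>x\<close> at time \<open>s\<close>.  The intensities
  \<open>\<Lambda> u\<close> need only be measurable in the time \<open>u\<close>, so Kolmogorov's (backward) equation is imposed in
  integrated form.  Its inner sum always converges absolutely, as \<open>0 \<le> P \<le> 1\<close> and the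
  rows of \<open>full_intensity (\<Lambda> u)\<close> are absolutely summable.
\<close>

definition transition_function ::
  "(real \<Rightarrow> 'e \<Rightarrow> 'e \<Rightarrow> real) \<Rightarrow> (real \<Rightarrow> real \<Rightarrow> 'e option \<Rightarrow> 'e option \<Rightarrow> real) \<Rightarrow> bool" where
  "transition_function \<Lambda> P \<longleftrightarrow>
     (\<forall>s t. 0 \<le> s \<and> s \<le> t \<longrightarrow>
        (\<forall>x. probability_vector (P s t x)) \<and>
        (\<forall>x y.
           set_integrable lborel {s..t} (\<lambda>u. \<Sum>\<^sub>\<infinity>z. full_intensity (\<Lambda> u) x z * P u t z y) \<and>
           P s t x y = of_bool (x = y) +
             (LBINT u:{s..t}. \<Sum>\<^sub>\<infinity>z. full_intensity (\<Lambda> u) x z * P u t z y)))"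

text \<open>
  Right-continuous with left limits for the discrete topology on the state space; equivalently,
  a step function with finitely many jumps in every bounded time interval.
\<close>

definition jump_path :: "(real \<Rightarrow> 's) \<Rightarrow> bool" where
  "jump_path x \<longleftrightarrow>
     (\<forall>t\<ge>0. \<forall>\<^sub>F u in at_right t. x u = x t) \<and>
     (\<forall>t>0. \<exists>y. \<forall>\<^sub>F u in at_left t. x u = y)"

text \<open>
  The Markov property is stated through finite-dimensional events, with the conditional
  probability multiplied out.
\<close>

definition markov_jump_process ::
  "'a measure \<Rightarrow> (real \<Rightarrow> 'a \<Rightarrow> 'e::countable option) \<Rightarrow> ('e \<Rightarrow> real) \<Rightarrow>
   (real \<Rightarrow> 'e \<Rightarrow> 'e \<Rightarrow> real) \<Rightarrow> bool" where
  "markov_jump_process M X \<alpha> \<Lambda> \<longleftrightarrow>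
     prob_space M \<and>
     probability_vector \<alpha> \<and>
     (\<forall>t\<ge>0. subintensity (\<Lambda> t)) \<and>
     (\<forall>t\<ge>0. X t \<in> measurable M (count_space UNIV)) \<and>
     (AE \<omega> in M. jump_path (\<lambda>t. X t \<omega>)) \<and>
     (\<forall>i. measure M {\<omega> \<in> space M. X 0 \<omega> = Some i} = \<alpha> i) \<and>
     (\<exists>P. transition_function \<Lambda> P \<and>
        (\<forall>(k::nat) (t :: nat \<Rightarrow> real) x. 0 \<le> t 0 \<and> (\<forall>l\<le>k. t l < t (Suc l)) \<longrightarrow>
           measure M {\<omega> \<in> space M. \<forall>l\<le>Suc k. X (t l) \<omega> = x l} =
           measure M {\<omega> \<in> space M. \<forall>l\<le>k. X (t l) \<omega> = x l} *
             P (t k) (t (Suc k)) (x k) (x (Suc k))))"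

definition termination_time :: "(real \<Rightarrow> 'a \<Rightarrow> 'e option) \<Rightarrow> 'a \<Rightarrow> ereal" where
  "termination_time X \<omega> = Inf (ereal ` {t. 0 \<le> t \<and> X t \<omega> = None})"

text \<open>
  \<open>\<mu>\<close> is the law of the (almost surely finite) termination time of a Markov jump process with
  initial distribution \<open>\<alpha>\<close> and subintensity matrix function \<open>\<Lambda>\<close>.  The definition has to name a type
  of outcomes for the process; sequences of reals are no restriction, since that space carries
  every law of such a process.
\<close>

definition termination_law ::
  "('e::countable \<Rightarrow> real) \<Rightarrow> (real \<Rightarrow> 'e \<Rightarrow> 'e \<Rightarrow> real) \<Rightarrow> real measure \<Rightarrow> bool" where
  "termination_law \<alpha> \<Lambda> \<mu> \<longleftrightarrow>
     (\<exists>(N :: (nat \<Rightarrow> real) measure) X T.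
        markov_jump_process N X \<alpha> \<Lambda> \<and>
        T \<in> borel_measurable N \<and>
        (AE \<omega> in N. termination_time X \<omega> = ereal (T \<omega>)) \<and>
        \<mu> = distr N borel T)"

definition IPH ::
  "('e::finite \<Rightarrow> real) \<Rightarrow> ('e \<Rightarrow> 'e \<Rightarrow> real) \<Rightarrow> (real \<Rightarrow> real) \<Rightarrow> real measure \<Rightarrow> bool" where
  "IPH \<alpha> S h \<mu> \<longleftrightarrow> termination_law \<alpha> (\<lambda>t i j. h t * S i j) \<mu>"

definition infinite_phase_type ::
  "(nat \<Rightarrow> real) \<Rightarrow> (nat \<Rightarrow> nat \<Rightarrow> real) \<Rightarrow> real measure \<Rightarrow> bool" where
  "infinite_phase_type \<alpha> S \<mu> \<longleftrightarrow> termination_law \<alpha> (\<lambda>t. S) \<mu>"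

text \<open>
  \<open>cox_Q h n l\<close> is meant for \<open>l \<ge> 1\<close>.  Rows and columns of \<open>cox_S h n\<close> are numbered from 0, so that
  row \<open>i\<close> contains \<open>cox_Q h n (Suc i)\<close>; likewise \<open>k\<close> stands for \<open>l - 1\<close> in \<open>cox_density\<close>.
\<close>

definition cox_Q :: "(real \<Rightarrow> real) \<Rightarrow> nat \<Rightarrow> nat \<Rightarrow> real" where
  "cox_Q h n l =
     1 - (LBINT s:{0..}. (real n * s) ^ (l - 1) / fact (l - 1) * exp (- (real n * s)) * h s)"

definition cox_S :: "(real \<Rightarrow> real) \<Rightarrow> nat \<Rightarrow> nat \<Rightarrow> nat \<Rightarrow> real" where
  "cox_S h n i j =
     (if j = i then - real n else if j = Suc i then real n * cox_Q h n (Suc i) else 0)"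

definition cox_density :: "(real \<Rightarrow> real) \<Rightarrow> nat \<Rightarrow> real \<Rightarrow> real" where
  "cox_density h n y =
     (\<Sum>k. ((1 - cox_Q h n (Suc k)) * (\<Prod>m=1..k. cox_Q h n m)) *
          (y ^ k / fact k) * real n ^ Suc k * exp (- (real n * y)))"

end

theory Submission
  imports Defs "HOL-Real_Asymp.Real_Asymp"
begin

text \<open>
  Write \<open>H\<close> for the cumulative hazard of \<open>Y\<close>, so that \<open>Y\<close> exceeds \<open>t\<close> with probability \<open>exp (- H t)\<close>.

  \<^bold>\<open>The one-dimensional description of Y.\<close>  A process that sits in its only state until time \<open>Y\<close> and is
  absorbed then survives from \<open>s\<close> to \<open>t\<close> with probability \<open>exp (H s - H t)\<close>.  The integrated backward
  equation for this expression is the chain rule applied to an indefinite integral of the hazard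
  rate.  The hazard rate is merely measurable and bounded, so \<open>H\<close> need not be differentiable everywhere;
  \<open>chain_rule_for_integrals\<close> gets around this by showing that the difference of the two sides is a
  function whose increments are quadratically small, hence a constant.

  \<^bold>\<open>The Coxian processes.\<close>  All states of the Coxian process have the same jump rate \<open>n\<close>, so the process
  is a Poisson process of rate \<open>n\<close> killed at an independent random arrival: the first \<open>k\<close> arrivals are
  survived with probability \<open>Q_1 \<cdots> Q_k\<close>.  It is built from independent exponential gaps and an
  independent integer lifetime.  The Markov property reduces to the one of the Poisson process, which
  rests on the loss of memory in the form \<open>emeasure_residual\<close>: given \<open>m\<close> arrivals up to time \<open>s\<close>, the gaps seen
  from time \<open>s\<close> on are again independent and exponential.  The transition probabilities are Poisson
  averages of the powers of the embedded jump chain (uniformization), from which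
  Kolmogorov's equation is read off by differentiating under the sum.  Conditioning on the lifetime
  gives the density as a mixture of Erlang densities.  The lifetime is almost surely finite because
  \<open>H\<close> tends to infinity (\<open>prod_cox_Q_tendsto_0\<close>).

  \<^bold>\<open>The limit.\<close>  Let \<open>A_k\<close> be the time of the \<open>k\<close>-th arrival and \<open>q_l = 1 - Q_l\<close>.  Since \<open>n q_l\<close> is the mean hazard
  rate at time \<open>A_l\<close>, Fubini's theorem gives \<open>q_1 + \<cdots> + q_k = E (H A_k)\<close> (\<open>expected_cumulative_hazard\<close>).
  Every \<open>q_l\<close> is at most \<open>C / n\<close>, where \<open>C\<close> bounds the hazard rate; so \<open>Q_1 \<cdots> Q_k\<close> differs from
  \<open>exp (- E (H A_k))\<close> by at most \<open>k (C / n)\<^sup>2\<close>, and \<open>E (H A_k)\<close> differs from \<open>H t\<close> by at most \<open>C E \<bar>A_k - t\<bar>\<close>.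
  The Coxian lifetime exceeds \<open>t\<close> with the probability \<open>E (Q_1 \<cdots> Q_k)\<close>, where \<open>k\<close> is now the Poisson number
  of arrivals up to time \<open>t\<close>.  The first two moments of the Poisson and Erlang laws then bound the
  distance of the two distribution functions at \<open>t\<close> by a multiple of \<open>(1 + t) / sqrt n\<close>
  (\<open>cdf_law_approx\<close>).
\<close>

section \<open>Poisson weights and Poisson averages\<close>

definition poisson_weight :: "nat \<Rightarrow> real \<Rightarrow> real" where
  "poisson_weight k x = x ^ k / fact k * exp (- x)"

lemma poisson_weight_nonneg: "0 \<le> x \<Longrightarrow> 0 \<le> poisson_weight k x"
  by (simp add: poisson_weight_def)

lemma poisson_weight_at_0: "poisson_weight k 0 = of_bool (k = 0)"
  by (simp add: poisson_weight_def power_0_left)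

lemma poisson_weight_measurable [measurable]: "poisson_weight k \<in> borel_measurable borel"
  unfolding poisson_weight_def by measurable

lemma poisson_weight_Suc: "real (Suc k) * poisson_weight (Suc k) x = x * poisson_weight k x"
proof -
  have "real (Suc k) * (x ^ Suc k / (real (Suc k) * fact k)) = x ^ Suc k / fact k"
    by (simp del: of_nat_Suc)
  then show ?thesis
    by (simp add: poisson_weight_def fact_Suc del: of_nat_Suc)
qed

lemma poisson_weight_sums: "(\<lambda>k. poisson_weight k x) sums 1"
proof -
  have "(\<lambda>k. exp (- x) * (x ^ k /\<^sub>R fact k)) sums (exp (- x) * exp x)"
    by (intro sums_mult exp_converges)
  then show ?thesis
    by (simp add: poisson_weight_def exp_minus field_simps)
qed

lemma poisson_mean_sums: "(\<lambda>k. real k * poisson_weight k x) sums x"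
proof -
  have "(\<lambda>k. real (Suc k) * poisson_weight (Suc k) x) sums (x * 1)"
    unfolding poisson_weight_Suc by (intro sums_mult poisson_weight_sums)
  then show ?thesis
    by (subst (asm) sums_Suc_iff) simp
qed

lemma poisson_second_moment_sums: "(\<lambda>k. (real k)\<^sup>2 * poisson_weight k x) sums (x\<^sup>2 + x)"
proof -
  have eq: "(real (Suc k))\<^sup>2 * poisson_weight (Suc k) x
      = x * (real k * poisson_weight k x) + x * poisson_weight k x" for k
  proof -
    have "(real (Suc k))\<^sup>2 * poisson_weight (Suc k) x
        = real (Suc k) * (real (Suc k) * poisson_weight (Suc k) x)"
      by (simp add: power2_eq_square)
    also have "\<dots> = x * (real k * poisson_weight k x) + x * poisson_weight k x"
      unfolding poisson_weight_Suc by (simp add: algebra_simps)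
    finally show ?thesis .
  qed
  have "(\<lambda>k. (real (Suc k))\<^sup>2 * poisson_weight (Suc k) x) sums (x * x + x * 1)"
    unfolding eq by (intro sums_add sums_mult poisson_mean_sums poisson_weight_sums)
  then show ?thesis
    by (subst (asm) sums_Suc_iff) (simp add: power2_eq_square)
qed

text \<open>The mean of \<open>c\<close> at a Poisson number of steps: the form taken by all quantities of a process
  that makes its jumps at the points of a Poisson process.\<close>

definition poisson_average :: "(nat \<Rightarrow> real) \<Rightarrow> real \<Rightarrow> real" where
  "poisson_average c x = (\<Sum>k. poisson_weight k x * c k)"

lemma summable_poisson_average:
  assumes "\<And>k. \<bar>c k\<bar> \<le> B" "0 \<le> x"
  shows "summable (\<lambda>k. poisson_weight k x * c k)"
proof (rule summable_comparison_test')
  show "summable (\<lambda>k. poisson_weight k x * B)"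
    by (intro summable_mult2 sums_summable[OF poisson_weight_sums])
  show "norm (poisson_weight k x * c k) \<le> poisson_weight k x * B" if "k \<ge> 0" for k
    using assms by (simp add: abs_mult mult_left_mono poisson_weight_nonneg)
qed

lemma poisson_average_at_0: "poisson_average c 0 = c 0"
proof -
  have "(\<lambda>k. poisson_weight k 0 * c k) = (\<lambda>k. if k = 0 then c k else 0)"
    by (auto simp: poisson_weight_at_0)
  then show ?thesis
    using sums_unique[OF sums_single[of 0 c]] by (simp add: poisson_average_def)
qed

lemma poisson_average_const: "poisson_average (\<lambda>k. a) x = a"
  using sums_mult2[OF poisson_weight_sums, of x a] by (simp add: poisson_average_def sums_iff)

lemma poisson_average_nonneg:
  assumes "\<And>k. 0 \<le> c k" "\<And>k. c k \<le> B" "0 \<le> x"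
  shows "0 \<le> poisson_average c x"
  unfolding poisson_average_def
  using assms by (intro suminf_nonneg summable_poisson_average[of c B]) (auto simp: poisson_weight_nonneg)

lemma poisson_average_linear:
  assumes "\<And>k. \<bar>c k\<bar> \<le> B" "\<And>k. \<bar>d k\<bar> \<le> B'" "0 \<le> x"
  shows "poisson_average (\<lambda>k. a * c k + b * d k) x = a * poisson_average c x + b * poisson_average d x"
proof -
  note sums = summable_sums[OF summable_poisson_average]
  have "(\<lambda>k. a * (poisson_weight k x * c k) + b * (poisson_weight k x * d k))
      sums (a * poisson_average c x + b * poisson_average d x)"
    unfolding poisson_average_def
    by (intro sums_add sums_mult sums[of c B] sums[of d B'] assms)
  then show ?thesis
    unfolding poisson_average_def by (simp add: algebra_simps sums_iff)
qed

text \<open>One more step happens at rate 1, and it replaces \<open>c\<close> by its shift.  This is the differential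
  equation behind Kolmogorov's equation for processes with a common jump rate.  Up to the factor
  \<open>exp (- x)\<close> the average is an exponential power series, and differentiating such a series shifts its
  coefficients.\<close>

lemma has_derivative_poisson_average:
  assumes B: "\<And>k. \<bar>c k\<bar> \<le> B"
  shows "(poisson_average c has_real_derivative
           (poisson_average (\<lambda>k. c (Suc k)) x - poisson_average c x)) (at x)"
proof -
  define E where "E c x = (\<Sum>k. c k / fact k * x ^ k)" for c :: "nat \<Rightarrow> real" and x
  have sm: "summable (\<lambda>k. c k / fact k * y ^ k)" if "\<And>k. \<bar>c k\<bar> \<le> B" for y and c :: "nat \<Rightarrow> real"
  proof (rule summable_comparison_test')
    show "summable (\<lambda>k. B * (\<bar>y\<bar> ^ k /\<^sub>R fact k))"
      by (intro summable_mult sums_summable[OF exp_converges])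
    show "norm (c k / fact k * y ^ k) \<le> B * (\<bar>y\<bar> ^ k /\<^sub>R fact k)" if "k \<ge> 0" for k
      using \<open>\<And>k. \<bar>c k\<bar> \<le> B\<close>[of k]
      by (simp add: abs_mult power_abs divide_inverse mult_right_mono mult_ac)
  qed
  have avg: "poisson_average c y = E c y * exp (- y)" if "\<And>k. \<bar>c k\<bar> \<le> B" for c y
  proof -
    have "poisson_average c y = (\<Sum>k. c k / fact k * y ^ k * exp (- y))"
      by (simp add: poisson_average_def poisson_weight_def mult_ac)
    also have "\<dots> = E c y * exp (- y)"
      unfolding E_def by (rule suminf_mult2[symmetric]) (rule sm[OF that])
    finally show ?thesis .
  qed
  have diffs: "diffs (\<lambda>k. c k / fact k) = (\<lambda>k. c (Suc k) / fact k)"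
    by (auto simp: diffs_def fun_eq_iff divide_simps)
  have "(E c has_real_derivative E (\<lambda>k. c (Suc k)) x) (at x)"
    using termdiffs_strong_converges_everywhere[of "\<lambda>k. c k / fact k" x, OF sm[OF B], unfolded diffs]
    unfolding E_def .
  then have "((\<lambda>y. E c y * exp (- y)) has_real_derivative
      E (\<lambda>k. c (Suc k)) x * exp (- x) + E c x * - exp (- x)) (at x)"
    by (auto intro!: derivative_eq_intros)
  moreover have "poisson_average c = (\<lambda>y. E c y * exp (- y))"
    using B by (auto simp: avg)
  ultimately show ?thesis
    using B by (simp add: avg)
qed

text \<open>The bound \<open>e\<close> may grow with \<open>k\<close>, as long as its own Poisson average is known.\<close>

lemma poisson_average_dist_le:
  assumes c: "\<And>k. \<bar>c k\<bar> \<le> B" and "0 \<le> x"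
    and e: "\<And>k. \<bar>c k - a\<bar> \<le> e k" "(\<lambda>k. poisson_weight k x * e k) sums s"
  shows "\<bar>poisson_average c x - a\<bar> \<le> s"
proof -
  have "(\<lambda>k. poisson_weight k x * c k) sums poisson_average c x"
    unfolding poisson_average_def by (rule summable_sums[OF summable_poisson_average[OF c \<open>0 \<le> x\<close>]])
  moreover have "(\<lambda>k. poisson_weight k x * a) sums (1 * a)"
    by (rule sums_mult2[OF poisson_weight_sums])
  ultimately have "(\<lambda>k. poisson_weight k x * (c k - a)) sums (poisson_average c x - a)"
    using sums_diff by (fastforce simp: right_diff_distrib)
  moreover have "norm (poisson_weight k x * (c k - a)) \<le> poisson_weight k x * e k" for k
    using e(1)[of k] \<open>0 \<le> x\<close> by (simp add: abs_mult poisson_weight_nonneg mult_left_mono)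
  ultimately have "norm (poisson_average c x - a) \<le> (\<Sum>k. poisson_weight k x * e k)"
    using norm_suminf_le[of "\<lambda>k. poisson_weight k x * (c k - a)" "\<lambda>k. poisson_weight k x * e k"] e(2)
    by (simp add: sums_iff)
  then show ?thesis
    using e(2) by (simp add: sums_iff)
qed

section \<open>A chain rule for indefinite integrals of bounded functions\<close>

text \<open>Quadratically small increments force the derivative to vanish at every point.\<close>

lemma constant_of_quadratic_increments:
  fixes D :: "real \<Rightarrow> real"
  assumes bound: "\<And>s t. a \<le> s \<Longrightarrow> s \<le> t \<Longrightarrow> t \<le> b \<Longrightarrow> \<bar>D t - D s\<bar> \<le> C * (t - s)\<^sup>2"
    and "a \<le> b"
  shows "D b = D a"
proof -
  have "\<exists>c. \<forall>x\<in>{a..b}. D x = c"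
  proof (rule has_vector_derivative_zero_constant)
    fix x assume x: "x \<in> {a..b}"
    have "((\<lambda>y. (D y - D x) / (y - x)) \<longlongrightarrow> 0) (at x within {a..b})"
    proof (rule Lim_null_comparison)
      show "\<forall>\<^sub>F y in at x within {a..b}. norm ((D y - D x) / (y - x)) \<le> C * \<bar>y - x\<bar>"
        unfolding eventually_at_filter
      proof (intro always_eventually allI impI)
        fix y assume y: "y \<noteq> x" "y \<in> {a..b}"
        have "\<bar>D y - D x\<bar> \<le> C * (y - x)\<^sup>2"
          using bound[of x y] bound[of y x] x y
          by (cases "x \<le> y") (auto simp: power2_commute abs_minus_commute)
        also have "\<dots> = (C * \<bar>y - x\<bar>) * \<bar>y - x\<bar>"
          by (simp add: power2_eq_square mult.assoc flip: abs_mult)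
        finally show "norm ((D y - D x) / (y - x)) \<le> C * \<bar>y - x\<bar>"
          using y by (simp add: divide_le_eq)
      qed
      show "((\<lambda>y. C * \<bar>y - x\<bar>) \<longlongrightarrow> 0) (at x within {a..b})"
        by (rule tendsto_eq_intros tendsto_ident_at tendsto_const | simp)+
    qed
    then have "(D has_real_derivative 0) (at x within {a..b})"
      by (simp add: has_field_derivative_iff)
    then show "(D has_vector_derivative 0) (at x within {a..b})"
      by (simp add: has_real_derivative_iff_has_vector_derivative)
  qed auto
  then show ?thesis
    using \<open>a \<le> b\<close> by auto
qed

lemma set_integral_singleton_lborel: "(LBINT u:{a}. g u) = (0 :: real)"
  unfolding set_lebesgue_integral_def
  by (rule integral_eq_zero_AE) (use AE_lborel_singleton[of a] in eventually_elim, auto)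

lemma set_integrable_Icc_bounded:
  fixes k :: "real \<Rightarrow> real"
  assumes "k \<in> borel_measurable borel" "\<And>u. u \<in> {s..t} \<Longrightarrow> \<bar>k u\<bar> \<le> K"
  shows "set_integrable lborel {s..t} k"
  unfolding set_integrable_def
  by (rule integrableI_bounded_set_indicator[where B = K])
     (use assms in \<open>auto intro!: AE_I2 simp: emeasure_lborel_Icc_eq\<close>)

lemma set_integral_Icc_bounded:
  fixes k :: "real \<Rightarrow> real"
  assumes "s \<le> t" "k \<in> borel_measurable borel" "\<And>u. u \<in> {s..t} \<Longrightarrow> \<bar>k u\<bar> \<le> K"
  shows "\<bar>LBINT u:{s..t}. k u\<bar> \<le> K * (t - s)"
proof -
  have "\<bar>LBINT u:{s..t}. k u\<bar> \<le> (LBINT u:{s..t}. \<bar>k u\<bar>)"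
    using set_integral_norm_bound[OF set_integrable_Icc_bounded[OF assms(2,3)]] by simp
  also have "\<dots> \<le> (LBINT u:{s..t}. K)"
    by (rule set_integral_mono)
      (use assms set_integrable_Icc_bounded[of "\<lambda>u. \<bar>k u\<bar>" s t K]
         set_integrable_Icc_bounded[of "\<lambda>u. K" s t "\<bar>K\<bar>"] in auto)
  also have "\<dots> = K * (t - s)"
    using assms(1) by (simp add: set_lebesgue_integral_def)
  finally show ?thesis .
qed

lemma set_integral_Icc_combine:
  fixes k :: "real \<Rightarrow> real"
  assumes "a \<le> s" "s \<le> t" "set_integrable lborel {a..t} k"
  shows "(LBINT u:{a..t}. k u) = (LBINT u:{a..s}. k u) + (LBINT u:{s..t}. k u)"
proof -
  have "{a..t} = {a..s} \<union> {s..t}"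
    using assms by auto
  then show ?thesis
    using assms AE_lborel_singleton[of s]
    by (auto intro!: set_integral_Un_AE intro: set_integrable_subset elim!: eventually_mono)
qed

text \<open>Lebesgue's differentiation theorem is avoided: \<open>\<phi> \<circ> \<Phi>\<close> minus the integral on the left has
  quadratically small increments, because the mean value theorem replaces \<open>\<phi>'\<close> by a constant on a short
  interval at the cost of a second factor proportional to the length of that interval.\<close>

lemma chain_rule_for_integrals:
  fixes \<Phi> g \<phi> \<phi>' :: "real \<Rightarrow> real"
  assumes "a \<le> b"
    and g [measurable]: "g \<in> borel_measurable borel"
    and g_bound: "\<And>u. u \<in> {a..b} \<Longrightarrow> \<bar>g u\<bar> \<le> C"
    and \<Phi>: "\<And>s t. a \<le> s \<Longrightarrow> s \<le> t \<Longrightarrow> t \<le> b \<Longrightarrow> \<Phi> t - \<Phi> s = (LBINT u:{s..t}. g u)"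
    and \<Phi>_meas [measurable]: "\<Phi> \<in> borel_measurable borel"
    and range: "\<And>u. u \<in> {a..b} \<Longrightarrow> \<Phi> u \<in> {lo..hi}"
    and \<phi>: "\<And>x. x \<in> {lo..hi} \<Longrightarrow> (\<phi> has_real_derivative \<phi>' x) (at x)"
    and Lipschitz: "\<And>x y. x \<in> {lo..hi} \<Longrightarrow> y \<in> {lo..hi} \<Longrightarrow> \<bar>\<phi>' x - \<phi>' y\<bar> \<le> L * \<bar>x - y\<bar>"
    and \<phi>'_meas [measurable]: "\<phi>' \<in> borel_measurable borel"
  shows "set_integrable lborel {a..b} (\<lambda>u. \<phi>' (\<Phi> u) * g u)"
    and "(LBINT u:{a..b}. \<phi>' (\<Phi> u) * g u) = \<phi> (\<Phi> b) - \<phi> (\<Phi> a)"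
proof -
  have L_nonneg: "0 \<le> \<bar>L\<bar>" and C_nonneg: "0 \<le> C"
    using g_bound[of a] \<open>a \<le> b\<close> by auto
  have \<Phi>_lip: "\<bar>\<Phi> t - \<Phi> s\<bar> \<le> C * (t - s)" if "a \<le> s" "s \<le> t" "t \<le> b" for s t
    using set_integral_Icc_bounded[of s t g C] g_bound \<Phi>[of s t] that by auto
  define B where "B = \<bar>\<phi>' (\<Phi> a)\<bar> + \<bar>L\<bar> * (C * (b - a))"
  have "\<bar>\<phi>' (\<Phi> u) * g u\<bar> \<le> B * C" if u: "u \<in> {a..b}" for u
  proof -
    have "\<bar>\<phi>' (\<Phi> u) - \<phi>' (\<Phi> a)\<bar> \<le> L * \<bar>\<Phi> u - \<Phi> a\<bar>"
      using Lipschitz range u \<open>a \<le> b\<close> by simp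
    also have "\<dots> \<le> \<bar>L\<bar> * \<bar>\<Phi> u - \<Phi> a\<bar>"
      by (intro mult_right_mono) auto
    also have "\<dots> \<le> \<bar>L\<bar> * (C * (b - a))"
    proof (intro mult_left_mono)
      have "\<bar>\<Phi> u - \<Phi> a\<bar> \<le> C * (u - a)"
        using \<Phi>_lip[of a u] u by auto
      also have "\<dots> \<le> C * (b - a)"
        using C_nonneg u by (intro mult_left_mono) auto
      finally show "\<bar>\<Phi> u - \<Phi> a\<bar> \<le> C * (b - a)" .
    qed simp
    finally have "\<bar>\<phi>' (\<Phi> u)\<bar> \<le> B"
      unfolding B_def by linarith
    then show ?thesis
      using g_bound[OF u] by (simp add: abs_mult mult_mono')
  qed note integrand_bound = this
  show "set_integrable lborel {a..b} (\<lambda>u. \<phi>' (\<Phi> u) * g u)"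
    by (rule set_integrable_Icc_bounded[OF _ integrand_bound]) auto
  define J where "J t = (LBINT u:{a..t}. \<phi>' (\<Phi> u) * g u)" for t
  define D where "D t = \<phi> (\<Phi> t) - J t" for t
  have "\<bar>D t - D s\<bar> \<le> (\<bar>L\<bar> * C * C) * (t - s)\<^sup>2" if st: "a \<le> s" "s \<le> t" "t \<le> b" for s t
  proof -
    have int_st: "set_integrable lborel {s..t} (\<lambda>u. \<phi>' (\<Phi> u) * g u)"
      by (rule set_integrable_Icc_bounded[of _ _ _ "B * C"]) (use integrand_bound st in auto)
    have J: "J t - J s = (LBINT u:{s..t}. \<phi>' (\<Phi> u) * g u)"
      using set_integral_Icc_combine[of a s t] st
        set_integrable_Icc_bounded[of "\<lambda>u. \<phi>' (\<Phi> u) * g u" a t "B * C"] integrand_bound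
      by (auto simp: J_def)
    \<comment> \<open>the two values of \<open>\<Phi>\<close> may come in either order, or coincide\<close>
    obtain \<xi> where \<xi>: "\<phi> (\<Phi> t) - \<phi> (\<Phi> s) = \<phi>' \<xi> * (\<Phi> t - \<Phi> s)"
      "\<xi> \<in> {min (\<Phi> s) (\<Phi> t)..max (\<Phi> s) (\<Phi> t)}"
    proof -
      consider "\<Phi> s = \<Phi> t" | "\<Phi> s < \<Phi> t" | "\<Phi> t < \<Phi> s" by linarith
      then show thesis
      proof cases
        case 1
        then show thesis by (intro that[of "\<Phi> s"]) auto
      next
        case 2
        then obtain z where "\<Phi> s < z" "z < \<Phi> t" "\<phi> (\<Phi> t) - \<phi> (\<Phi> s) = (\<Phi> t - \<Phi> s) * \<phi>' z"
          using MVT2[of "\<Phi> s" "\<Phi> t" \<phi> \<phi>'] \<phi> range[of s] range[of t] st by auto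
        then show thesis by (intro that[of z]) auto
      next
        case 3
        then obtain z where "\<Phi> t < z" "z < \<Phi> s" "\<phi> (\<Phi> s) - \<phi> (\<Phi> t) = (\<Phi> s - \<Phi> t) * \<phi>' z"
          using MVT2[of "\<Phi> t" "\<Phi> s" \<phi> \<phi>'] \<phi> range[of s] range[of t] st by auto
        then show thesis by (intro that[of z]) (auto simp: algebra_simps)
      qed
    qed
    have \<xi>_range: "\<xi> \<in> {lo..hi}"
      using \<xi>(2) range[of s] range[of t] st by auto
    have int_g: "set_integrable lborel {s..t} (\<lambda>u. \<phi>' \<xi> * g u)"
      by (intro set_integrable_mult_right set_integrable_Icc_bounded[of _ _ _ C]) (use g_bound st in auto)
    have "D t - D s = (LBINT u:{s..t}. \<phi>' \<xi> * g u) - (LBINT u:{s..t}. \<phi>' (\<Phi> u) * g u)"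
      using \<xi>(1) J \<Phi>[OF st] by (simp add: D_def)
    also have "\<dots> = (LBINT u:{s..t}. (\<phi>' \<xi> - \<phi>' (\<Phi> u)) * g u)"
      using set_integral_diff(2)[OF int_g int_st] by (simp add: left_diff_distrib)
    also have "\<bar>\<dots>\<bar> \<le> (\<bar>L\<bar> * (C * (t - s)) * C) * (t - s)"
    proof (rule set_integral_Icc_bounded)
      fix u assume u: "u \<in> {s..t}"
      have "\<bar>\<xi> - \<Phi> u\<bar> \<le> C * (t - s)"
      proof -
        have "\<bar>\<Phi> u - \<Phi> s\<bar> \<le> C * (t - s)" "\<bar>\<Phi> t - \<Phi> u\<bar> \<le> C * (t - s)"
          using \<Phi>_lip[of s u] \<Phi>_lip[of u t] u st C_nonneg
            mult_left_mono[of "u - s" "t - s" C] mult_left_mono[of "t - u" "t - s" C]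
          by auto
        then show ?thesis
          using \<xi>(2) by (auto simp: min_def max_def split: if_splits)
      qed
      then have "\<bar>\<phi>' \<xi> - \<phi>' (\<Phi> u)\<bar> \<le> \<bar>L\<bar> * (C * (t - s))"
        using Lipschitz[OF \<xi>_range range, of u] u st
          mult_mono[OF abs_ge_self[of L], of "\<bar>\<xi> - \<Phi> u\<bar>" "C * (t - s)"]
        by auto
      then show "\<bar>(\<phi>' \<xi> - \<phi>' (\<Phi> u)) * g u\<bar> \<le> \<bar>L\<bar> * (C * (t - s)) * C"
        using g_bound[of u] u st by (simp add: abs_mult mult_mono')
    qed (use st in auto)
    finally show ?thesis
      by (simp add: power2_eq_square mult_ac)
  qed
  then have "D b = D a"
    using constant_of_quadratic_increments[of a b D] \<open>a \<le> b\<close> by blast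
  moreover have "J a = 0"
    by (simp add: J_def set_integral_singleton_lborel)
  ultimately show "(LBINT u:{a..b}. \<phi>' (\<Phi> u) * g u) = \<phi> (\<Phi> b) - \<phi> (\<Phi> a)"
    by (simp add: D_def J_def)
qed

section \<open>Markov jump processes and their termination laws\<close>

lemma increasing_times_nonneg:
  fixes t :: "nat \<Rightarrow> real"
  assumes "0 \<le> t 0" "\<forall>l\<le>k. t l < t (Suc l)" "l \<le> Suc k"
  shows "0 \<le> t l"
  using assms(3)
proof (induction l)
  case (Suc l)
  then show ?case using assms(2)[rule_format, of l] by auto
qed (use assms in simp)

lemma increasing_times_mono:
  fixes t :: "nat \<Rightarrow> real"
  assumes "\<forall>l\<le>k. t l < t (Suc l)" "l \<le> m" "m \<le> Suc k"
  shows "t l \<le> t m"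
  using assms(2,3)
proof (induction m rule: dec_induct)
  case (step m)
  then show ?case using assms(1)[rule_format, of m] by auto
qed simp

lemma (in finite_measure) has_sum_measure_partition:
  fixes Z :: "'a \<Rightarrow> 'e :: countable"
  assumes Z [measurable]: "Z \<in> measurable M (count_space UNIV)" and A [measurable]: "A \<in> sets M"
  shows "((\<lambda>y. measure M (A \<inter> {\<omega> \<in> space M. Z \<omega> = y})) has_sum measure M A) UNIV"
proof -
  define m where "m y = measure M (A \<inter> {\<omega> \<in> space M. Z \<omega> = y})" for y
  have "A = (\<Union>y. A \<inter> {\<omega> \<in> space M. Z \<omega> = y})"
    using sets.sets_into_space[OF A] by auto
  then have "emeasure M A = emeasure M (\<Union>y. A \<inter> {\<omega> \<in> space M. Z \<omega> = y})"
    by simp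
  also have "\<dots> = (\<integral>\<^sup>+y. emeasure M (A \<inter> {\<omega> \<in> space M. Z \<omega> = y}) \<partial>count_space UNIV)"
    by (rule emeasure_UN_countable) (auto simp: disjoint_family_on_def)
  also have "\<dots> = (\<integral>\<^sup>+y. ennreal (m y) \<partial>count_space UNIV)"
    by (simp add: m_def emeasure_eq_measure)
  finally have *: "(\<integral>\<^sup>+y. ennreal (m y) \<partial>count_space UNIV) = ennreal (measure M A)"
    by (simp add: emeasure_eq_measure)
  then have "integrable (count_space UNIV) m"
    by (intro integrableI_nonneg) (auto simp: m_def)
  then have sm: "Infinite_Set_Sum.abs_summable_on m UNIV"
    by (simp add: abs_summable_on_def)
  then have "ennreal (infsetsum m UNIV) = ennreal (measure M A)"
    using * by (subst nn_integral_conv_infsetsum[symmetric]) (auto simp: m_def)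
  then have "infsetsum m UNIV = measure M A"
    by (subst (asm) ennreal_inj) (auto intro!: infsetsum_nonneg simp: m_def)
  then have "infsum m UNIV = measure M A"
    using infsetsum_infsum[OF sm] by simp
  moreover have "m summable_on UNIV"
    by (rule abs_summable_summable[OF abs_summable_equivalent[THEN iffD2, OF sm]])
  ultimately show ?thesis
    using has_sum_infsum[of m UNIV] unfolding m_def[symmetric] by simp
qed

text \<open>For laws on \<open>'e option\<close>: the mass of the absorbing state is determined by the masses of the
  other states.\<close>

lemma has_sum_option_determined:
  fixes p q :: "'e option \<Rightarrow> real"
  assumes "(p has_sum c) UNIV" "(q has_sum c) UNIV" "\<And>i. p (Some i) = q (Some i)"
  shows "p None = q None"
proof -
  have "((\<lambda>x. p x + - q x) has_sum (c + - c)) UNIV"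
    by (intro has_sum_add has_sum_uminusI assms)
  moreover have "((\<lambda>x. p x + - q x) has_sum (p None + - q None)) UNIV"
    by (rule has_sum_finite_neutralI[of "{None}"]) (auto simp: assms(3) not_None_eq)
  ultimately have "p None + - q None = c + - c"
    by (rule has_sum_unique[rotated])
  then show ?thesis by simp
qed

lemma finite_dimensional_event_sets:
  fixes k :: nat
  assumes "\<And>l. l \<le> k \<Longrightarrow> X (t l) \<in> measurable M (count_space UNIV)"
  shows "{\<omega> \<in> space M. \<forall>l\<le>k. X (t l) \<omega> = x l} \<in> sets M"
proof -
  have "{\<omega> \<in> space M. \<forall>l\<le>k. X (t l) \<omega> = x l} = (\<Inter>l\<in>{..k}. X (t l) -` {x l} \<inter> space M)"
    by auto
  also have "\<dots> \<in> sets M"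
    by (intro sets.finite_INT measurable_sets[OF assms]) auto
  finally show ?thesis .
qed

text \<open>Only events along which the process stays alive have to be examined for the Markov property.
  Once the process is absorbed, the next state is forced; and the probability that it is absorbed
  in the next step is the complement of the probabilities of the live states.\<close>

lemma markov_jump_processI:
  fixes X :: "real \<Rightarrow> 'a \<Rightarrow> 'e::countable option"
  assumes "prob_space M"
    and "probability_vector \<alpha>" "\<And>t. 0 \<le> t \<Longrightarrow> subintensity (\<Lambda> t)"
    and X [measurable]: "\<And>t. 0 \<le> t \<Longrightarrow> X t \<in> measurable M (count_space UNIV)"
    and "AE \<omega> in M. jump_path (\<lambda>t. X t \<omega>)"
    and "\<And>i. measure M {\<omega> \<in> space M. X 0 \<omega> = Some i} = \<alpha> i"
    and P: "transition_function \<Lambda> P"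
    and P_None: "\<And>s t y. 0 \<le> s \<Longrightarrow> s \<le> t \<Longrightarrow> P s t None y = of_bool (y = None)"
    and absorbing: "\<And>\<omega> s t. \<omega> \<in> space M \<Longrightarrow> 0 \<le> s \<Longrightarrow> s \<le> t \<Longrightarrow> X s \<omega> = None \<Longrightarrow> X t \<omega> = None"
    and alive: "\<And>k t j. 0 \<le> t 0 \<Longrightarrow> \<forall>l\<le>k. t l < t (Suc l) \<Longrightarrow>
       measure M {\<omega> \<in> space M. \<forall>l\<le>Suc k. X (t l) \<omega> = Some (j l)} =
       measure M {\<omega> \<in> space M. \<forall>l\<le>k. X (t l) \<omega> = Some (j l)} *
         P (t k) (t (Suc k)) (Some (j k)) (Some (j (Suc k)))"
  shows "markov_jump_process M X \<alpha> \<Lambda>"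
proof -
  interpret prob_space M by fact
  have fdd: "measure M {\<omega> \<in> space M. \<forall>l\<le>Suc k. X (t l) \<omega> = x l} =
      measure M {\<omega> \<in> space M. \<forall>l\<le>k. X (t l) \<omega> = x l} * P (t k) (t (Suc k)) (x k) (x (Suc k))"
    (is "measure M ?B = measure M ?A * _")
    if t: "0 \<le> t 0" "\<forall>l\<le>k. t l < t (Suc l)" for k t x
  proof -
    note t_nonneg = increasing_times_nonneg[OF t] and t_mono = increasing_times_mono[OF t(2)]
    have le_Suc: "(\<forall>l\<le>Suc k. X (t l) \<omega> = x l)
        \<longleftrightarrow> (\<forall>l\<le>k. X (t l) \<omega> = x l) \<and> X (t (Suc k)) \<omega> = x (Suc k)" for \<omega>
      using le_Suc_eq by auto
    show ?thesis
    proof (cases "x k")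
      case None
      have "X (t (Suc k)) \<omega> = None" if "\<omega> \<in> ?A" for \<omega>
        using that None absorbing[of \<omega> "t k" "t (Suc k)"] t_nonneg[of k] t_mono[of k "Suc k"] by auto
      then have "?B = (if x (Suc k) = None then ?A else {})"
        unfolding le_Suc by auto
      then show ?thesis
        using P_None[of "t k" "t (Suc k)" "x (Suc k)"] t_nonneg[of k] t_mono[of k "Suc k"] None
        by auto
    next
      case (Some i)
      show ?thesis
      proof (cases "\<exists>l\<le>k. x l = None")
        case True
        then obtain l where l: "l \<le> k" "x l = None" by blast
        have "?A = {}"
        proof safe
          fix \<omega> assume "\<omega> \<in> space M" "\<forall>l\<le>k. X (t l) \<omega> = x l"
          then have "X (t l) \<omega> = None" "X (t k) \<omega> = Some i"
            using l Some by auto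
          then show "\<omega> \<in> {}"
            using absorbing[OF \<open>\<omega> \<in> space M\<close>, of "t l" "t k"] t_nonneg[of l] t_mono[of l k] l by auto
        qed
        moreover from this have "?B = {}" unfolding le_Suc by blast
        ultimately show ?thesis by (simp only: measure_empty mult_zero_left)
      next
        case False
        then have x: "x l = Some (the (x l))" if "l \<le> k" for l
          using that by (cases "x l") auto
        let ?P = "P (t k) (t (Suc k)) (Some i)"
        define m where "m y = measure M (?A \<inter> {\<omega> \<in> space M. X (t (Suc k)) \<omega> = y})" for y
        have tSuc [measurable]: "X (t (Suc k)) \<in> measurable M (count_space UNIV)"
          using t_nonneg[of "Suc k"] by (intro X) auto
        have A [measurable]: "?A \<in> sets M"
          by (intro finite_dimensional_event_sets X) (use t_nonneg in auto)
        have m_Some: "m (Some j) = measure M ?A * ?P (Some j)" for j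
        proof -
          define j' where "j' l = (if l = Suc k then j else the (x l))" for l
          have *: "l \<le> k \<Longrightarrow> Some (j' l) = x l" for l
            by (simp add: j'_def x[symmetric])
          have j'_Suc: "j' (Suc k) = j"
            by (simp add: j'_def)
          have 1: "{\<omega> \<in> space M. \<forall>l\<le>k. X (t l) \<omega> = Some (j' l)} = ?A"
            by (auto simp: *)
          have 2: "{\<omega> \<in> space M. \<forall>l\<le>Suc k. X (t l) \<omega> = Some (j' l)}
              = ?A \<inter> {\<omega> \<in> space M. X (t (Suc k)) \<omega> = Some j}"
            by (auto simp: le_Suc_eq * j'_Suc)
          show ?thesis
            using alive[OF t, of j'] *[of k] Some unfolding 1 2 m_def by (simp add: j'_Suc)
        qed
        have "(m has_sum measure M ?A) UNIV"
          unfolding m_def by (rule has_sum_measure_partition[OF tSuc A])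
        moreover have "probability_vector ?P"
          using P[unfolded transition_function_def, rule_format, of "t k" "t (Suc k)"]
            t_nonneg[of k] t_mono[of k "Suc k"] by simp
        then have "(?P has_sum 1) UNIV"
          by (simp add: probability_vector_def)
        then have "((\<lambda>y. measure M ?A * ?P y) has_sum measure M ?A) UNIV"
          using has_sum_cmult_right[of ?P UNIV 1 "measure M ?A"] by simp
        ultimately have m_None: "m None = measure M ?A * ?P None"
          by (rule has_sum_option_determined) (rule m_Some)
        have "?B = ?A \<inter> {\<omega> \<in> space M. X (t (Suc k)) \<omega> = x (Suc k)}"
          unfolding le_Suc by auto
        then have "measure M ?B = m (x (Suc k))"
          by (simp add: m_def)
        also have "\<dots> = measure M ?A * ?P (x (Suc k))"
          by (cases "x (Suc k)") (simp_all add: m_Some m_None)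
        finally show ?thesis using Some by simp
      qed
    qed
  qed
  show ?thesis
    unfolding markov_jump_process_def
  proof (intro conjI exI[of _ P] allI impI)
    fix k and t :: "nat \<Rightarrow> real" and x
    assume "0 \<le> t 0 \<and> (\<forall>l\<le>k. t l < t (Suc l))"
    then show "measure M {\<omega> \<in> space M. \<forall>l\<le>Suc k. X (t l) \<omega> = x l} =
      measure M {\<omega> \<in> space M. \<forall>l\<le>k. X (t l) \<omega> = x l} * P (t k) (t (Suc k)) (x k) (x (Suc k))"
      by (intro fdd) auto
  qed (rule assms | assumption)+
qed

text \<open>The process may live on any probability space that embeds measurably into the sequences of
  reals, as its law can be transported along the embedding.\<close>

lemma termination_lawI:
  fixes N :: "'a measure" and X :: "real \<Rightarrow> 'a \<Rightarrow> 'e::countable option"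
  assumes X: "markov_jump_process N X \<alpha> \<Lambda>"
    and T: "T \<in> borel_measurable N"
    and stops: "AE \<omega> in N. termination_time X \<omega> = ereal (T \<omega>)"
    and enc: "enc \<in> measurable N (PiM UNIV (\<lambda>i::nat. borel :: real measure))"
    and dec: "dec \<in> measurable (PiM UNIV (\<lambda>i::nat. borel :: real measure)) N"
    and dec_enc: "\<And>\<omega>. \<omega> \<in> space N \<Longrightarrow> dec (enc \<omega>) = \<omega>"
  shows "termination_law \<alpha> \<Lambda> (distr N borel T)"
proof -
  let ?S = "PiM UNIV (\<lambda>i::nat. borel :: real measure)"
  define N' where "N' = distr N ?S enc"
  have N'_sets [measurable_cong, simp]: "sets N' = sets ?S"
    by (simp add: N'_def)
  have dec' [measurable]: "dec \<in> measurable N' N"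
    using dec by (simp cong: measurable_cong_sets)
  have N: "distr N' N dec = N"
  proof -
    have "distr N' N dec = distr N N (dec \<circ> enc)"
      unfolding N'_def by (rule distr_distr[OF dec enc])
    also have "\<dots> = distr N N (\<lambda>\<omega>. \<omega>)"
      by (rule distr_cong) (auto simp: dec_enc)
    finally show ?thesis by (simp add: distr_id)
  qed
  have AE_dec: "AE \<omega> in N'. Pr (dec \<omega>)" if "AE \<omega> in N. Pr \<omega>" for Pr
  proof -
    have "AE \<omega> in distr N' N dec. Pr \<omega>"
      using that by (subst N)
    then show ?thesis
      by (rule AE_distrD[OF dec'])
  qed
  have measure_dec: "measure N' {\<omega> \<in> space N'. Pr (dec \<omega>)} = measure N {\<omega> \<in> space N. Pr \<omega>}"
    if "{\<omega> \<in> space N. Pr \<omega>} \<in> sets N" for Pr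
  proof -
    have "measure N {\<omega> \<in> space N. Pr \<omega>} = measure (distr N' N dec) {\<omega> \<in> space N. Pr \<omega>}"
      by (simp add: N)
    also have "\<dots> = measure N' (dec -` {\<omega> \<in> space N. Pr \<omega>} \<inter> space N')"
      by (rule measure_distr[OF dec' that])
    also have "dec -` {\<omega> \<in> space N. Pr \<omega>} \<inter> space N' = {\<omega> \<in> space N'. Pr (dec \<omega>)}"
      using measurable_space[OF dec'] by auto
    finally show ?thesis by simp
  qed
  have X_meas [measurable]: "0 \<le> t \<Longrightarrow> X t \<in> measurable N (count_space UNIV)" for t
    using X by (simp add: markov_jump_process_def)
  have event: "{\<omega> \<in> space N. \<forall>l\<le>m. X (t l) \<omega> = x l} \<in> sets N"
    if "\<And>l. l \<le> m \<Longrightarrow> 0 \<le> t l" for m :: nat and t x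
    by (intro finite_dimensional_event_sets X_meas that)
  have "markov_jump_process N' (\<lambda>t \<omega>. X t (dec \<omega>)) \<alpha> \<Lambda>"
  proof -
    obtain P where P: "transition_function \<Lambda> P"
      and fdd: "\<And>k t x. 0 \<le> t 0 \<Longrightarrow> \<forall>l\<le>k. t l < t (Suc l) \<Longrightarrow>
           measure N {\<omega> \<in> space N. \<forall>l\<le>Suc k. X (t l) \<omega> = x l} =
           measure N {\<omega> \<in> space N. \<forall>l\<le>k. X (t l) \<omega> = x l} * P (t k) (t (Suc k)) (x k) (x (Suc k))"
      using X by (auto simp: markov_jump_process_def)
    have "measure N' {\<omega> \<in> space N'. \<forall>l\<le>Suc k. X (t l) (dec \<omega>) = x l} =
           measure N' {\<omega> \<in> space N'. \<forall>l\<le>k. X (t l) (dec \<omega>) = x l} * P (t k) (t (Suc k)) (x k) (x (Suc k))"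
      if t: "0 \<le> t 0" "\<forall>l\<le>k. t l < t (Suc l)" for k t x
    proof -
      have nn: "l \<le> Suc k \<Longrightarrow> 0 \<le> t l" for l
        by (rule increasing_times_nonneg[OF t])
      show ?thesis
        using fdd[OF t, of x] measure_dec[OF event[of "Suc k" t x]] measure_dec[OF event[of k t x]] nn
        by simp
    qed
    moreover have "measure N' {\<omega> \<in> space N'. X 0 (dec \<omega>) = Some i} = \<alpha> i" for i
    proof -
      have "{\<omega> \<in> space N. X 0 \<omega> = Some i} \<in> sets N"
        using event[of 0 "\<lambda>_. 0" "\<lambda>_. Some i"] by simp
      from measure_dec[OF this] show ?thesis
        using X by (simp add: markov_jump_process_def)
    qed
    moreover have "prob_space N'"
      unfolding N'_def using X by (intro prob_space.prob_space_distr enc) (simp add: markov_jump_process_def)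
    moreover have "AE \<omega> in N'. jump_path (\<lambda>t. X t (dec \<omega>))"
      using X by (intro AE_dec) (simp add: markov_jump_process_def)
    moreover have "(\<lambda>\<omega>. X t (dec \<omega>)) \<in> measurable N' (count_space UNIV)" if "0 \<le> t" for t
      using that by measurable
    moreover have "probability_vector \<alpha>" "\<forall>t\<ge>0. subintensity (\<Lambda> t)"
      using X by (simp_all add: markov_jump_process_def)
    ultimately show ?thesis
      unfolding markov_jump_process_def using P by (intro conjI exI[of _ P] allI impI) simp_all
  qed
  moreover have "AE \<omega> in N'. termination_time (\<lambda>t \<omega>. X t (dec \<omega>)) \<omega> = ereal (T (dec \<omega>))"
    using AE_dec[OF stops] by (simp add: termination_time_def)
  moreover have "(\<lambda>\<omega>. T (dec \<omega>)) \<in> borel_measurable N'"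
    using T by measurable
  moreover have "distr N borel T = distr N' borel (\<lambda>\<omega>. T (dec \<omega>))"
    using distr_distr[OF T dec'] by (simp add: N comp_def)
  ultimately show ?thesis
    unfolding termination_law_def by blast
qed

lemma jump_pathI:
  assumes "\<And>t. 0 \<le> t \<Longrightarrow> \<exists>b>t. \<forall>u. t < u \<and> u < b \<longrightarrow> x u = x t"
    and "\<And>t. 0 < t \<Longrightarrow> \<exists>a<t. \<exists>y. \<forall>u. a < u \<and> u < t \<longrightarrow> x u = y"
  shows "jump_path x"
  unfolding jump_path_def
proof (intro conjI allI impI)
  fix t :: real assume "0 \<le> t"
  then obtain b where "b > t" "\<forall>u. t < u \<and> u < b \<longrightarrow> x u = x t"
    using assms(1) by blast
  then show "\<forall>\<^sub>F u in at_right t. x u = x t"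
    by (auto simp: eventually_at_right[of t b])
next
  fix t :: real assume "0 < t"
  then obtain a y where "a < t" "\<forall>u. a < u \<and> u < t \<longrightarrow> x u = y"
    using assms(2) by blast
  then have "\<forall>\<^sub>F u in at_left t. x u = y"
    by (auto simp: eventually_at_left[of a t])
  then show "\<exists>y. \<forall>\<^sub>F u in at_left t. x u = y" ..
qed

lemma termination_timeI:
  assumes "0 \<le> T" "\<And>t. 0 \<le> t \<Longrightarrow> X t \<omega> = None \<longleftrightarrow> T \<le> t"
  shows "termination_time X \<omega> = ereal T"
proof -
  have "{t. 0 \<le> t \<and> X t \<omega> = None} = {T..}"
    using assms by auto
  moreover have "Inf (ereal ` {T..}) = ereal T"
    by (rule antisym[OF Inf_lower Inf_greatest]) auto
  ultimately show ?thesis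
    by (simp add: termination_time_def)
qed

section \<open>The survival function of a law with bounded hazard rate\<close>

text \<open>The bound is required at every point of \<open>[0, \<infinity>)\<close>.  Where the survival function vanishes, the
  bound says nothing about \<open>f\<close>; that this does not happen is \<open>survival_pos\<close> below.\<close>

locale bounded_hazard = real_distribution \<mu> for \<mu> :: "real measure" +
  fixes f :: "real \<Rightarrow> real" and C :: real
  assumes f_nonneg: "\<And>x. 0 \<le> f x"
    and f_measurable [measurable]: "f \<in> borel_measurable borel"
    and density_f: "\<mu> = density lborel (\<lambda>x. ennreal (f x))"
    and support: "AE x in \<mu>. 0 \<le> x"
    and hazard_le: "\<And>t. 0 \<le> t \<Longrightarrow> hazard_rate \<mu> f t \<le> C"
begin

abbreviation h :: "real \<Rightarrow> real" where "h \<equiv> hazard_rate \<mu> f"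

definition survival :: "real \<Rightarrow> real" where "survival t = 1 - cdf \<mu> t"

lemma survival_nonneg: "0 \<le> survival t" and survival_le_1: "survival t \<le> 1"
  using cdf_bounded_prob[of t] cdf_nonneg[of t] by (auto simp: survival_def)

lemma survival_antimono: "s \<le> t \<Longrightarrow> survival t \<le> survival s"
  using cdf_nondecreasing[of s t] by (simp add: survival_def)

lemma survival_measurable [measurable]: "survival \<in> borel_measurable borel"
proof -
  have "mono (cdf \<mu>)" by (intro monoI cdf_nondecreasing)
  then show ?thesis
    unfolding survival_def[abs_def] by (intro borel_measurable_diff borel_measurable_mono) auto
qed

lemma hazard_eq: "h t = f t / survival t"
  by (simp add: hazard_rate_def survival_def)

lemma hazard_measurable [measurable]: "h \<in> borel_measurable borel"
  unfolding hazard_eq[abs_def] by measurable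

lemma hazard_nonneg: "0 \<le> h t"
  by (simp add: hazard_eq f_nonneg survival_nonneg)

lemma C_nonneg: "0 \<le> C"
  using hazard_nonneg[of 0] hazard_le[of 0] by simp

lemma emeasure_mu: "A \<in> sets borel \<Longrightarrow> emeasure \<mu> A = (\<integral>\<^sup>+x. ennreal (f x) * indicator A x \<partial>lborel)"
  by (subst density_f) (simp add: emeasure_density)

lemma f_integrable: "integrable lborel f"
proof (rule integrableI_nonneg)
  have "(\<integral>\<^sup>+x. ennreal (f x) \<partial>lborel) = 1"
    using emeasure_mu[of UNIV] emeasure_space_1 by simp
  then show "(\<integral>\<^sup>+x. ennreal (f x) \<partial>lborel) < \<infinity>" by simp
qed (auto simp: f_nonneg)

lemma prob_eq: "A \<in> sets borel \<Longrightarrow> measure \<mu> A = (LBINT u:A. f u)"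
proof -
  assume A [measurable]: "A \<in> sets borel"
  have "ennreal (measure \<mu> A) = (\<integral>\<^sup>+x. ennreal (indicator A x * f x) \<partial>lborel)"
    unfolding emeasure_eq_measure[symmetric] emeasure_mu[OF A]
    by (intro nn_integral_cong) (auto split: split_indicator)
  also have "\<dots> = ennreal (LBINT x. indicator A x * f x)"
    using f_nonneg integrable_mult_indicator[of A lborel f] f_integrable
    by (intro nn_integral_eq_integral) auto
  finally show ?thesis
    using f_nonneg by (simp add: set_lebesgue_integral_def integral_nonneg)
qed

lemma prob_singleton: "measure \<mu> {x} = 0"
  by (simp add: prob_eq set_integral_singleton_lborel)

lemma continuous_survival: "isCont survival t"
  unfolding survival_def[abs_def] by (intro continuous_intros) (simp add: isCont_cdf prob_singleton)

lemma prob_greater: "measure \<mu> {t<..} = survival t"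
proof -
  have "{t<..} = space \<mu> - {..t}" by auto
  then show ?thesis
    using prob_compl[of "{..t}"] by (simp add: survival_def cdf_def)
qed

lemma survival_diff:
  assumes "s \<le> t"
  shows "survival s - survival t = (LBINT u:{s..t}. f u)"
proof (cases "s = t")
  case False
  have "measure \<mu> {s..t} = measure \<mu> ({s} \<union> {s<..t})"
    using assms by (intro arg_cong[where f = "measure \<mu>"]) auto
  also have "\<dots> = measure \<mu> {s} + measure \<mu> {s<..t}"
    by (rule finite_measure_Union) auto
  also have "\<dots> = cdf \<mu> t - cdf \<mu> s"
    using False assms by (simp add: prob_singleton cdf_diff_eq)
  finally show ?thesis
    by (simp add: survival_def prob_eq)
qed (simp add: set_integral_singleton_lborel)

lemma survival_negative: "t \<le> 0 \<Longrightarrow> survival t = 1"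
proof -
  assume "t \<le> 0"
  have "measure \<mu> {..0} = measure \<mu> {0}"
  proof (rule measure_eq_AE)
    show "AE x in \<mu>. (x \<in> {..0}) = (x \<in> {0})"
      using support by eventually_elim auto
  qed auto
  then have "cdf \<mu> 0 = 0"
    by (simp add: cdf_def prob_singleton)
  then have "cdf \<mu> t = 0"
    using cdf_nondecreasing[OF \<open>t \<le> 0\<close>] cdf_nonneg[of t] by simp
  then show ?thesis by (simp add: survival_def)
qed

text \<open>If \<open>b\<close> were the first zero of the survival function, then for \<open>s\<close> shortly before \<open>b\<close> all of the mass
  \<open>survival s\<close> would have to die on \<open>[s, b]\<close>, at a rate of at most \<open>C * survival s\<close>; the interval is too
  short for that as soon as \<open>C * (b - s) < 1\<close>.\<close>

lemma survival_pos: "0 < survival t"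
proof (rule ccontr)
  assume "\<not> 0 < survival t"
  then have t: "survival t = 0" using survival_nonneg[of t] by simp
  define Z where "Z = {u \<in> {0..}. survival u = 0}"
  define b where "b = Inf Z"
  have "closed Z"
    unfolding Z_def
    by (intro continuous_closed_preimage_constant continuous_at_imp_continuous_on ballI continuous_survival) auto
  moreover have "t \<in> Z"
    using t survival_negative[of t] by (cases "t \<le> 0") (auto simp: Z_def)
  moreover have bdd: "bdd_below Z"
    by (rule bdd_belowI[of _ 0]) (auto simp: Z_def)
  ultimately have "b \<in> Z"
    unfolding b_def by (intro closed_contains_Inf) auto
  then have b: "0 \<le> b" "survival b = 0" by (auto simp: Z_def)
  with survival_negative[of b] have "0 < b" by (cases "b \<le> 0") auto
  \<comment> \<open>so close to \<open>b\<close> that \<open>C * (b - s) \<le> 1 / 2\<close>\<close>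
  define s where "s = max 0 (b - 1 / (2 * (C + 1)))"
  have s: "0 \<le> s" "s < b" "b - s \<le> 1 / (2 * (C + 1))"
    using \<open>0 < b\<close> C_nonneg by (auto simp: s_def)
  have alive: "0 < survival u" if "0 \<le> u" "u < b" for u
  proof -
    have "u \<notin> Z"
      using cInf_lower[OF _ bdd, of u] that by (auto simp: b_def)
    then show ?thesis
      using that survival_nonneg[of u] by (auto simp: Z_def)
  qed
  have "survival s = (LBINT u:{s..b}. f u)"
    using survival_diff[of s b] s b by simp
  also have "\<dots> \<le> (LBINT u:{s..b}. C * survival s)"
    unfolding set_lebesgue_integral_def
  proof (rule integral_mono_AE)
    show "integrable lborel (\<lambda>x. indicat_real {s..b} x *\<^sub>R f x)"
      using integrable_real_mult_indicator[OF _ f_integrable, of "{s..b}"] by (simp add: mult.commute)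
    show "AE x in lborel. indicat_real {s..b} x *\<^sub>R f x \<le> indicat_real {s..b} x *\<^sub>R (C * survival s)"
      using AE_lborel_singleton[of b]
    proof eventually_elim
      fix x assume "x \<noteq> b"
      have "f x \<le> C * survival s" if x: "s \<le> x" "x < b"
      proof -
        have "f x = h x * survival x"
          using alive[of x] x s by (simp add: hazard_eq)
        also have "\<dots> \<le> C * survival s"
          using x s hazard_le[of x] survival_antimono[of s x] hazard_nonneg[of x] survival_nonneg
          by (intro mult_mono C_nonneg) auto
        finally show ?thesis .
      qed
      with \<open>x \<noteq> b\<close> show "indicat_real {s..b} x *\<^sub>R f x \<le> indicat_real {s..b} x *\<^sub>R (C * survival s)"
        by (auto simp: indicator_def)
    qed
  qed (auto simp: emeasure_lborel_Icc_eq)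
  also have "\<dots> = survival s * (C * (b - s))"
    using s by (simp add: set_lebesgue_integral_def mult_ac)
  also have "\<dots> \<le> survival s * (1 / 2)"
  proof (rule mult_left_mono)
    have "C * (b - s) \<le> C * (1 / (2 * (C + 1)))"
      using s C_nonneg by (intro mult_left_mono) auto
    also have "\<dots> \<le> 1 / 2"
      using C_nonneg by (simp add: field_simps)
    finally show "C * (b - s) \<le> 1 / 2" .
  qed (rule survival_nonneg)
  finally show False
    using alive[of s] s by simp
qed

lemma f_eq: "f t = h t * survival t"
  using survival_pos[of t] by (simp add: hazard_eq)

lemma f_le: "0 \<le> t \<Longrightarrow> f t \<le> C"
  using mult_mono[OF hazard_le survival_le_1, of t t] C_nonneg survival_nonneg f_eq[of t] by simp

text \<open>The survival function is an indefinite integral of \<open>- f\<close>, with values between \<open>survival t\<close> and 1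
  up to time \<open>t\<close>.  The bound on \<open>\<phi>''\<close> there supplies the Lipschitz constant of \<open>\<phi>'\<close>.\<close>

lemma survival_chain_rule:
  fixes \<phi> \<phi>' \<phi>'' :: "real \<Rightarrow> real"
  assumes "0 \<le> s" "s \<le> t"
    and "\<And>x. 0 < x \<Longrightarrow> (\<phi> has_real_derivative \<phi>' x) (at x)"
    and "\<And>x. 0 < x \<Longrightarrow> (\<phi>' has_real_derivative \<phi>'' x) (at x)"
    and "\<And>x. survival t \<le> x \<Longrightarrow> x \<le> 1 \<Longrightarrow> \<bar>\<phi>'' x\<bar> \<le> L"
    and [measurable]: "\<phi>' \<in> borel_measurable borel"
  shows "set_integrable lborel {s..t} (\<lambda>u. - \<phi>' (survival u) * f u)"
    and "(LBINT u:{s..t}. - \<phi>' (survival u) * f u) = \<phi> (survival t) - \<phi> (survival s)"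
proof -
  have 1: "\<bar>- f u\<bar> \<le> C" if "u \<in> {s..t}" for u
    using f_le[of u] f_nonneg[of u] that assms by simp
  have 2: "survival b - survival a = (LBINT u:{a..b}. - f u)" if "a \<le> b" for a b
    using survival_diff[OF that] by (simp add: set_lebesgue_integral_def)
  have 3: "\<bar>\<phi>' x - \<phi>' y\<bar> \<le> L * \<bar>x - y\<bar>" if "x \<in> {survival t..1}" "y \<in> {survival t..1}" for x y
  proof -
    have "norm (\<phi>' x - \<phi>' y) \<le> L * norm (x - y)"
    proof (rule field_differentiable_bound[of "{survival t..1}"])
      fix z assume "z \<in> {survival t..1}"
      then show "(\<phi>' has_field_derivative \<phi>'' z) (at z within {survival t..1})" "norm (\<phi>'' z) \<le> L"
        using assms(4)[of z] assms(5)[of z] survival_pos[of t] by (auto intro: DERIV_subset)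
    qed (use that in auto)
    then show ?thesis by simp
  qed
  have 4: "(\<phi> has_real_derivative \<phi>' x) (at x)" if "x \<in> {survival t..1}" for x
    using assms(3)[of x] that survival_pos[of t] by auto
  have 5: "survival u \<in> {survival t..1}" if "u \<in> {s..t}" for u
    using that survival_antimono[of u t] survival_le_1 by auto
  note * = chain_rule_for_integrals[where \<Phi> = survival and g = "\<lambda>u. - f u" and C = C and lo = "survival t" and hi = 1
      and \<phi> = \<phi> and \<phi>' = \<phi>' and L = L, OF \<open>s \<le> t\<close> _ 1 2 _ 5 4 3]
  show "set_integrable lborel {s..t} (\<lambda>u. - \<phi>' (survival u) * f u)"
    using *(1) by simp
  show "(LBINT u:{s..t}. - \<phi>' (survival u) * f u) = \<phi> (survival t) - \<phi> (survival s)"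
    using *(2) by simp
qed

definition cumulative_hazard :: "real \<Rightarrow> real" where
  "cumulative_hazard t = (LBINT u:{0..t}. h u)"

text \<open>The chain rule for the logarithm.\<close>

lemma survival_eq_exp:
  assumes "0 \<le> t"
  shows "survival t = exp (- cumulative_hazard t)"
proof -
  have "(LBINT u:{0..t}. - (- inverse (survival u)) * f u) = - ln (survival t) - - ln (survival 0)"
  proof (rule survival_chain_rule(2)[where \<phi> = "\<lambda>x. - ln x" and \<phi>' = "\<lambda>x. - inverse x" and \<phi>'' = "\<lambda>x. inverse (x\<^sup>2)" and L = "inverse ((survival t)\<^sup>2)"])
    fix x :: real assume "0 < x"
    then show "((\<lambda>x. - ln x) has_real_derivative - inverse x) (at x)"
      by (auto intro!: derivative_eq_intros simp: divide_inverse)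
    show "((\<lambda>x. - inverse x) has_real_derivative inverse (x\<^sup>2)) (at x)"
      using \<open>0 < x\<close> by (auto intro!: derivative_eq_intros simp: power2_eq_square)
  next
    fix x assume "survival t \<le> x"
    then show "\<bar>inverse (x\<^sup>2)\<bar> \<le> inverse ((survival t)\<^sup>2)"
      using survival_pos[of t] by (auto intro!: le_imp_inverse_le power_mono)
  qed (use assms in auto)
  then have "ln (survival t) = - cumulative_hazard t"
    by (simp add: survival_negative cumulative_hazard_def hazard_eq divide_inverse mult.commute)
  then show ?thesis
    using survival_pos[of t] by (metis exp_ln)
qed

text \<open>The chain rule for the reciprocal; this is the backward equation of the one-dimensional process.\<close>

lemma hazard_backward_integral:
  assumes "0 \<le> s" "s \<le> t"
  shows "set_integrable lborel {s..t} (\<lambda>u. h u * (survival t / survival u))"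
    and "(LBINT u:{s..t}. h u * (survival t / survival u)) = 1 - survival t / survival s"
proof -
  have *: "((\<lambda>x. inverse x) has_real_derivative - inverse (x\<^sup>2)) (at x)"
    "((\<lambda>x. - inverse (x\<^sup>2)) has_real_derivative 2 * inverse (x ^ 3)) (at x)" if "0 < x" for x :: real
    using that by (auto intro!: derivative_eq_intros simp: field_simps power2_eq_square power3_eq_cube)
  have L: "\<bar>2 * inverse (x ^ 3)\<bar> \<le> 2 * inverse ((survival t) ^ 3)" if "survival t \<le> x" for x
    using that survival_pos[of t] by (auto intro!: le_imp_inverse_le power_mono)
  note chain = survival_chain_rule[where \<phi> = "\<lambda>x. inverse x" and \<phi>' = "\<lambda>x. - inverse (x\<^sup>2)"
      and \<phi>'' = "\<lambda>x. 2 * inverse (x ^ 3)" and L = "2 * inverse ((survival t) ^ 3)", OF assms * L]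
  have eq: "h u * (survival t / survival u) = survival t * (- (- inverse ((survival u)\<^sup>2)) * f u)" for u
    using survival_pos[of u] by (simp add: hazard_eq power2_eq_square field_simps)
  show "set_integrable lborel {s..t} (\<lambda>u. h u * (survival t / survival u))"
    unfolding eq by (intro set_integrable_mult_right chain(1)) auto
  show "(LBINT u:{s..t}. h u * (survival t / survival u)) = 1 - survival t / survival s"
    unfolding eq set_integral_mult_right using chain(2) survival_pos[of s] survival_pos[of t]
    by (simp add: field_simps)
qed

end

section \<open>The law as a one-dimensional inhomogeneous phase-type law\<close>

context bounded_hazard
begin

text \<open>The process \<open>X\<close> is the canonical one on the law itself: alive strictly before the sampled
  value, absorbed from then on.\<close>

theorem IPH_hazard: "IPH (\<lambda>i::unit. 1) (\<lambda>i j. - 1) h \<mu>"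
proof -
  define X :: "real \<Rightarrow> real \<Rightarrow> unit option" where "X t y = (if t < y then Some () else None)" for t y
  define P :: "real \<Rightarrow> real \<Rightarrow> unit option \<Rightarrow> unit option \<Rightarrow> real" where
    "P s t x y = (case x of None \<Rightarrow> of_bool (y = None)
       | Some _ \<Rightarrow> (case y of Some _ \<Rightarrow> survival t / survival s | None \<Rightarrow> 1 - survival t / survival s))" for s t x y
  have states: "(UNIV :: unit option set) = {None, Some ()}"
    by (auto simp: UNIV_option_conv UNIV_unit)
  have sum_states: "(\<Sum>\<^sub>\<infinity>z. g z) = g None + g (Some ())" for g :: "unit option \<Rightarrow> real"
    by (simp add: states)
  have transition: "transition_function (\<lambda>t i j. h t * - 1) P"
    unfolding transition_function_def
  proof (intro allI impI conjI)
    fix s t :: real and x assume st: "0 \<le> s \<and> s \<le> t"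
    have "survival t / survival s \<le> 1"
      using st survival_antimono[of s t] survival_pos[of s] by simp
    moreover have "0 \<le> survival t / survival s"
      by (simp add: survival_nonneg)
    moreover have "(P s t x has_sum (\<Sum>z\<in>UNIV. P s t x z)) UNIV"
      by (rule has_sum_finite) (simp add: states)
    ultimately show "probability_vector (P s t x)"
      by (cases x) (auto simp: probability_vector_def P_def states split: option.split)
  next
    fix s t :: real and x y assume st: "0 \<le> s \<and> s \<le> t"
    have row: "(\<Sum>\<^sub>\<infinity>z. full_intensity (\<lambda>i j. h u * - 1) x z * P u t z y)
        = (if x = None then 0 else (if y = None then 1 else - 1)) * (h u * (survival t / survival u))" for u
      unfolding sum_states by (cases x; cases y) (auto simp: full_intensity_def P_def algebra_simps)
    note int = hazard_backward_integral[of s t]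
    show "set_integrable lborel {s..t}
        (\<lambda>u. \<Sum>\<^sub>\<infinity>z. full_intensity (\<lambda>i j. h u * - 1) x z * P u t z y)"
      unfolding row using int(1) st by (intro set_integrable_mult_right) auto
    show "P s t x y = of_bool (x = y) +
        (LBINT u:{s..t}. \<Sum>\<^sub>\<infinity>z. full_intensity (\<lambda>i j. h u * - 1) x z * P u t z y)"
      unfolding row set_integral_mult_right using int(2) st
      by (cases x; cases y) (auto simp: P_def)
  qed
  have process: "markov_jump_process \<mu> X (\<lambda>i. 1) (\<lambda>t i j. h t * - 1)"
  proof (rule markov_jump_processI[OF _ _ _ _ _ _ transition])
    show "prob_space \<mu>" by unfold_locales
    have "((\<lambda>i::unit. 1 :: real) has_sum (\<Sum>i\<in>(UNIV :: unit set). 1)) UNIV"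
      by (rule has_sum_finite) simp
    then show "probability_vector (\<lambda>i::unit. 1)"
      by (simp add: probability_vector_def)
    show "subintensity (\<lambda>(i::unit) (j::unit). h t * - 1)" for t
      by (auto simp: subintensity_def hazard_nonneg)
    show "X t \<in> measurable \<mu> (count_space UNIV)" for t
      unfolding X_def by measurable
    show "AE y in \<mu>. jump_path (\<lambda>t. X t y)"
    proof (intro AE_I2 jump_pathI)
      fix y t :: real
      show "\<exists>b>t. \<forall>u. t < u \<and> u < b \<longrightarrow> X u y = X t y"
        by (rule exI[of _ "if t < y then y else t + 1"]) (auto simp: X_def)
      show "\<exists>a<t. \<exists>z. \<forall>u. a < u \<and> u < t \<longrightarrow> X u y = z"
        by (cases "t \<le> y")
          (rule exI[of _ "t - 1"] exI[of _ y], auto simp: X_def intro!: exI[of _ "Some ()"] exI[of _ None])+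
    qed
    show "measure \<mu> {y \<in> space \<mu>. X 0 y = Some i} = 1" for i
    proof -
      have "{y \<in> space \<mu>. X 0 y = Some i} = {0<..}"
        by (auto simp: X_def)
      then show ?thesis
        by (simp add: prob_greater survival_negative)
    qed
    show "P s t None y = of_bool (y = None)" for s t y
      by (simp add: P_def)
    show "X t y = None" if "s \<le> t" "X s y = None" for y s t
      using that by (auto simp: X_def split: if_splits)
    show "measure \<mu> {y \<in> space \<mu>. \<forall>l\<le>Suc k. X (t l) y = Some (j l)} =
       measure \<mu> {y \<in> space \<mu>. \<forall>l\<le>k. X (t l) y = Some (j l)} *
         P (t k) (t (Suc k)) (Some (j k)) (Some (j (Suc k)))"
      if t: "\<forall>l\<le>k. t l < t (Suc l)" for k and t :: "nat \<Rightarrow> real" and j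
    proof -
      have alive: "{y \<in> space \<mu>. \<forall>l\<le>m. X (t l) y = Some (j l)} = {t m<..}" if "m \<le> Suc k" for m
        using increasing_times_mono[OF t _ that] by (force simp: X_def)
      show ?thesis
        unfolding alive[OF order_refl] alive[OF le_SucI[OF order_refl]] prob_greater
        using survival_pos[of "t k"] by (simp add: P_def)
    qed
  qed
  have "termination_law (\<lambda>i::unit. 1) (\<lambda>t i j. h t * - 1) (distr \<mu> borel (\<lambda>y. y))"
  proof (rule termination_lawI[OF process])
    show "AE y in \<mu>. termination_time X y = ereal y"
      using support by eventually_elim (intro termination_timeI, auto simp: X_def)
    show "(\<lambda>y i. y) \<in> measurable \<mu> (PiM UNIV (\<lambda>i::nat. borel))"
      by (rule measurable_PiM_single') auto
    show "(\<lambda>\<omega>. \<omega> 0) \<in> measurable (PiM UNIV (\<lambda>i::nat. borel)) \<mu>"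
      by (subst measurable_cong_sets[OF refl events_eq_borel]) measurable
  qed auto
  then show ?thesis
    by (simp add: IPH_def distr_id2)
qed

end

section \<open>Poisson arrivals from independent exponential gaps\<close>

text \<open>Outcomes are the sequences \<open>\<omega>\<close> of waiting times between consecutive arrivals.\<close>

definition arrival :: "nat \<Rightarrow> (nat \<Rightarrow> real) \<Rightarrow> real" where
  "arrival m \<omega> = (\<Sum>i<m. \<omega> i)"

text \<open>The waiting times as seen from time \<open>s\<close>, when \<open>m\<close> arrivals have already happened: first the rest of
  the current one, then all later ones.\<close>

definition residual :: "real \<Rightarrow> nat \<Rightarrow> (nat \<Rightarrow> real) \<Rightarrow> nat \<Rightarrow> real" where
  "residual s m \<omega> = case_nat (arrival (Suc m) \<omega> - s) (\<lambda>i. \<omega> (Suc m + i))"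

text \<open>A counting process that starts in \<open>i\<close> and increases by 1 at each arrival is in state \<open>m\<close> at time \<open>t\<close>.
  The starting state is a parameter so that the process seen from a later time has the same form.\<close>

definition in_state :: "nat \<Rightarrow> real \<Rightarrow> nat \<Rightarrow> (nat \<Rightarrow> real) \<Rightarrow> bool" where
  "in_state i t m \<omega> \<longleftrightarrow> i \<le> m \<and> arrival (m - i) \<omega> \<le> t \<and> t < arrival (Suc m - i) \<omega>"

lemma arrival_0 [simp]: "arrival 0 \<omega> = 0"
  by (simp add: arrival_def)

lemma arrival_Suc: "arrival (Suc m) \<omega> = arrival m \<omega> + \<omega> m"
  by (simp add: arrival_def)

lemma arrival_Suc_case_nat [simp]: "arrival (Suc m) (case_nat e \<omega>) = e + arrival m \<omega>"
  unfolding arrival_def by (subst sum.lessThan_Suc_shift) simp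

lemma arrival_mono:
  assumes "\<And>i. 0 < \<omega> i" "m \<le> m'"
  shows "arrival m \<omega> \<le> arrival m' \<omega>"
  unfolding arrival_def using assms by (intro sum_mono2) (auto intro: less_imp_le)

lemma arrival_residual: "arrival (Suc d) (residual s m \<omega>) = arrival (m + Suc d) \<omega> - s"
proof -
  have "arrival (Suc m + d) \<omega> = arrival (Suc m) \<omega> + arrival d (\<lambda>i. \<omega> (Suc m + i))"
    by (induction d) (simp_all add: arrival_Suc)
  then show ?thesis by (simp add: residual_def)
qed

lemma residual_case_nat: "residual s (Suc m) (case_nat e \<omega>) = residual (s - e) m \<omega>"
  by (auto simp: residual_def fun_eq_iff split: nat.split)

lemma in_state_residual:
  assumes pos: "\<And>i. 0 < \<omega> i" and "0 \<le> u" and st: "in_state i s m \<omega>"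
  shows "in_state i (s + u) m' \<omega> \<longleftrightarrow> in_state m u m' (residual s (m - i) \<omega>)"
proof -
  have s: "i \<le> m" "arrival (m - i) \<omega> \<le> s" "s < arrival (Suc m - i) \<omega>"
    using st by (auto simp: in_state_def)
  consider "m' < m" | "m' = m" | d where "m' = m + Suc d"
    by (metis less_imp_Suc_add linorder_neqE_nat add_Suc_right)
  then show ?thesis
  proof cases
    case 1
    then have "i \<le> m' \<Longrightarrow> arrival (Suc m' - i) \<omega> \<le> arrival (m - i) \<omega>"
      by (intro arrival_mono pos) auto
    then show ?thesis
      using 1 s \<open>0 \<le> u\<close> by (auto simp: in_state_def)
  next
    case 2
    have "arrival (Suc 0) (residual s (m - i) \<omega>) = arrival (Suc m - i) \<omega> - s"
      using s by (simp add: arrival_residual Suc_diff_le)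
    then show ?thesis
      using 2 s \<open>0 \<le> u\<close> by (auto simp: in_state_def)
  next
    case 3
    have "arrival (Suc d) (residual s (m - i) \<omega>) = arrival (m' - i) \<omega> - s"
      and "arrival (Suc (Suc d)) (residual s (m - i) \<omega>) = arrival (Suc m' - i) \<omega> - s"
      using s 3 by (simp_all add: arrival_residual Suc_diff_le)
    then show ?thesis
      using 3 s by (auto simp: in_state_def Suc_diff_le)
  qed
qed

locale poisson_arrivals =
  fixes r :: real
  assumes r_pos: "0 < r"
begin

definition gap :: "real measure" where
  "gap = density lborel (exponential_density r)"

definition gaps :: "(nat \<Rightarrow> real) measure" where
  "gaps = PiM UNIV (\<lambda>_. gap)"

lemma sets_gap [measurable_cong, simp]: "sets gap = sets borel"
  by (simp add: gap_def)

lemma space_gap [simp]: "space gap = UNIV"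
  by (simp add: gap_def)

lemma sets_gaps [measurable_cong]: "sets gaps = sets (PiM UNIV (\<lambda>_. borel))"
  unfolding gaps_def by (intro sets_PiM_cong) auto

lemma space_gaps [simp]: "space gaps = UNIV"
  by (simp add: gaps_def space_PiM PiE_UNIV_domain)

sublocale gap: prob_space gap
  unfolding gap_def by (rule prob_space_exponential_density[OF r_pos])

sublocale gap_sequence: sequence_space gap ..

sublocale gaps: prob_space gaps
  unfolding gaps_def by (intro prob_space_PiM) unfold_locales

lemma prob_gaps_UNIV [simp]: "measure gaps UNIV = 1"
  using gaps.prob_space by simp

lemma arrival_measurable [measurable]: "arrival m \<in> borel_measurable gaps"
  unfolding arrival_def[abs_def] by measurable

lemma case_nat_measurable [measurable]: "(\<lambda>(e, \<omega>). case_nat e \<omega>) \<in> measurable (gap \<Otimes>\<^sub>M gaps) gaps"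
  unfolding gaps_def by measurable

lemma residual_measurable [measurable]: "residual s m \<in> measurable gaps gaps"
proof -
  have "residual s m \<in> measurable gaps (PiM UNIV (\<lambda>_. borel))"
  proof (rule measurable_PiM_single')
    fix i
    show "(\<lambda>\<omega>. residual s m \<omega> i) \<in> borel_measurable gaps"
      unfolding residual_def by (cases i) simp_all
  qed auto
  then show ?thesis by (simp cong: measurable_cong_sets add: sets_gaps)
qed

lemma in_state_measurable [measurable]: "Measurable.pred gaps (in_state i t m)"
  unfolding in_state_def[abs_def] by measurable

lemma residual_event_sets:
  assumes [measurable]: "B \<in> sets gaps"
  shows "{\<omega>. in_state i s m \<omega> \<and> residual u k \<omega> \<in> B} \<in> sets gaps"
proof -
  have "{\<omega> \<in> space gaps. in_state i s m \<omega> \<and> residual u k \<omega> \<in> B} \<in> sets gaps"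
    by measurable
  then show ?thesis by simp
qed

lemma states_event_sets:
  fixes k :: nat
  shows "{\<omega>. \<forall>l\<le>k. in_state i (t l) (j l) \<omega>} \<in> sets gaps"
  using finite_dimensional_event_sets[of k "\<lambda>l. in_state i (t l) (j l)" "\<lambda>l. l" gaps "\<lambda>_. True"]
  by (simp add: in_state_measurable)

text \<open>Splitting off the first waiting time.\<close>

lemma emeasure_gaps_first:
  assumes [measurable]: "A \<in> sets gaps"
  shows "emeasure gaps A = (\<integral>\<^sup>+e. emeasure gaps {\<omega>. case_nat e \<omega> \<in> A} \<partial>gap)"
proof -
  have "emeasure gaps A = emeasure (distr (gap \<Otimes>\<^sub>M gaps) gaps (\<lambda>(e, \<omega>). case_nat e \<omega>)) A"
    using gap_sequence.PiM_iter by (simp add: gaps_def)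
  also have "\<dots> = emeasure (gap \<Otimes>\<^sub>M gaps) ((\<lambda>(e, \<omega>). case_nat e \<omega>) -` A \<inter> space (gap \<Otimes>\<^sub>M gaps))"
    by (rule emeasure_distr[OF case_nat_measurable assms])
  also have "\<dots> = (\<integral>\<^sup>+e. emeasure gaps {\<omega>. case_nat e \<omega> \<in> A} \<partial>gap)"
    by (subst gaps.emeasure_pair_measure_alt[OF measurable_sets[OF case_nat_measurable assms]])
      (auto intro!: nn_integral_cong arg_cong2[where f = emeasure] simp: space_pair_measure)
  finally show ?thesis .
qed

lemma AE_gap_pos: "AE e in gap. 0 < e"
  unfolding gap_def
  by (subst AE_density) (use AE_lborel_singleton[of 0] in \<open>auto elim!: eventually_mono simp: exponential_density_def\<close>)

lemma AE_gaps_pos: "AE \<omega> in gaps. \<forall>i. 0 < \<omega> i"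
  unfolding AE_all_countable gaps_def
  by (intro allI AE_PiM_component AE_gap_pos) (auto intro: gap.prob_space_axioms)

text \<open>Loss of memory of the exponential law.\<close>

lemma nn_integral_gap_beyond:
  assumes F [measurable]: "F \<in> borel_measurable borel" and "0 \<le> s"
  shows "(\<integral>\<^sup>+e. indicator {s<..} e * F (e - s) \<partial>gap) = ennreal (exp (- (r * s))) * (\<integral>\<^sup>+e. F e \<partial>gap)"
proof -
  have "(\<integral>\<^sup>+e. indicator {s<..} e * F (e - s) \<partial>gap)
      = (\<integral>\<^sup>+e. ennreal (exponential_density r e) * (indicator {s<..} e * F (e - s)) \<partial>lborel)"
    unfolding gap_def by (rule nn_integral_density) auto
  also have "\<dots> = (\<integral>\<^sup>+x. ennreal (exponential_density r (s + x)) * (indicator {s<..} (s + x) * F x) \<partial>lborel)"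
    by (subst nn_integral_real_affine[where c = 1 and t = s]) auto
  also have "\<dots> = (\<integral>\<^sup>+x. ennreal (exp (- (r * s))) * (ennreal (exponential_density r x) * F x) \<partial>lborel)"
  proof (rule nn_integral_cong_AE)
    show "AE x in lborel. ennreal (exponential_density r (s + x)) * (indicator {s<..} (s + x) * F x)
        = ennreal (exp (- (r * s))) * (ennreal (exponential_density r x) * F x)"
      using AE_lborel_singleton[of 0]
    proof eventually_elim
      fix x :: real assume "x \<noteq> 0"
      have "exponential_density r (s + x) = exp (- (r * s)) * exponential_density r x" if "0 < x"
        using that \<open>0 \<le> s\<close> by (simp add: exponential_density_def exp_add[symmetric] algebra_simps)
      then show "ennreal (exponential_density r (s + x)) * (indicator {s<..} (s + x) * F x)
          = ennreal (exp (- (r * s))) * (ennreal (exponential_density r x) * F x)"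
        using \<open>x \<noteq> 0\<close> by (cases "0 < x") (auto simp: ennreal_mult' mult.assoc exponential_density_def)
    qed
  qed
  also have "\<dots> = ennreal (exp (- (r * s))) * (\<integral>\<^sup>+x. ennreal (exponential_density r x) * F x \<partial>lborel)"
    by (rule nn_integral_cmult) auto
  also have "(\<integral>\<^sup>+x. ennreal (exponential_density r x) * F x \<partial>lborel) = (\<integral>\<^sup>+e. F e \<partial>gap)"
    unfolding gap_def by (rule nn_integral_density[symmetric]) auto
  finally show ?thesis .
qed

text \<open>If the first arrival comes at time \<open>e\<close>, then \<open>m + 1\<close> arrivals up to time \<open>s\<close> mean \<open>m\<close> arrivals in the
  remaining time \<open>s - e\<close>; so this is the recursion of the Poisson probabilities.\<close>

lemma nn_integral_gap_poisson_weight: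
  assumes "0 \<le> s"
  shows "(\<integral>\<^sup>+e. indicator {..s} e * ennreal (poisson_weight m (r * (s - e))) \<partial>gap)
    = ennreal (poisson_weight (Suc m) (r * s))"
proof -
  define F where "F e = - exp (- (r * s)) * ((r * (s - e)) ^ Suc m / fact (Suc m))" for e
  define F' where "F' e = exp (- (r * s)) * (r * ((r * (s - e)) ^ m / fact m))" for e
  have "(\<integral>\<^sup>+e. indicator {..s} e * ennreal (poisson_weight m (r * (s - e))) \<partial>gap)
      = (\<integral>\<^sup>+e. ennreal (exponential_density r e) * (indicator {..s} e * ennreal (poisson_weight m (r * (s - e)))) \<partial>lborel)"
    unfolding gap_def by (rule nn_integral_density) auto
  also have "\<dots> = (\<integral>\<^sup>+e. ennreal (F' e) * indicator {0..s} e \<partial>lborel)"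
  proof (rule nn_integral_cong)
    fix e
    have "exponential_density r e * poisson_weight m (r * (s - e)) = F' e" if "0 \<le> e" "e \<le> s"
      using that by (simp add: exponential_density_def poisson_weight_def F'_def exp_add[symmetric] algebra_simps)
    then show "ennreal (exponential_density r e) * (indicator {..s} e * ennreal (poisson_weight m (r * (s - e))))
        = ennreal (F' e) * indicator {0..s} e"
      using r_pos by (cases "0 \<le> e") (auto simp: ennreal_mult'[symmetric] exponential_density_def split: split_indicator)
  qed
  also have "\<dots> = ennreal (F s - F 0)"
  proof (rule nn_integral_FTC_Icc)
    show "F' \<in> borel_measurable borel"
      unfolding F'_def by measurable
    fix e assume e: "e \<in> {0..s}"
    show "0 \<le> F' e"
      using e r_pos by (simp add: F'_def)
    have fact: "real (Suc m) * y / fact (Suc m) = y / fact m" for y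
      by (simp add: fact_Suc del: of_nat_Suc)
    have "((\<lambda>e. (r * (s - e)) ^ Suc m) has_real_derivative real (Suc m) * (- r * (r * (s - e)) ^ m)) (at e)"
      by (rule derivative_eq_intros refl | simp)+
    from DERIV_cmult[OF DERIV_cdivide[OF this, of "fact (Suc m)"], of "- exp (- (r * s))"]
    have "(F has_real_derivative - exp (- (r * s)) * (real (Suc m) * (- r * (r * (s - e)) ^ m) / fact (Suc m))) (at e)"
      unfolding F_def .
    then show "(F has_real_derivative F' e) (at e)"
      unfolding fact by (simp add: F'_def)
  qed fact
  also have "F s - F 0 = poisson_weight (Suc m) (r * s)"
    by (simp add: F_def poisson_weight_def)
  finally show ?thesis .
qed

text \<open>The Markov property of the Poisson process at a fixed time, together with the law of its state.
  The proof is by induction on the number of arrivals, splitting off the first waiting time: without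
  an arrival up to time \<open>s\<close> it is the loss of memory, and otherwise it is the induction hypothesis after
  a restart at the first arrival.\<close>

theorem emeasure_residual:
  assumes B [measurable]: "B \<in> sets gaps" and "0 \<le> s"
  shows "emeasure gaps {\<omega>. in_state 0 s m \<omega> \<and> residual s m \<omega> \<in> B}
    = ennreal (poisson_weight m (r * s)) * emeasure gaps B"
  using \<open>0 \<le> s\<close>
proof (induction m arbitrary: s)
  case 0
  define F where "F e = emeasure gaps {\<omega>. case_nat e \<omega> \<in> B}" for e
  have [measurable]: "F \<in> borel_measurable borel"
  proof -
    have "(\<lambda>e. emeasure gaps {\<omega> \<in> space gaps. case_nat e \<omega> \<in> B}) \<in> borel_measurable gap"
      by measurable
    then show ?thesis by (simp add: F_def[abs_def] cong: measurable_cong_sets)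
  qed
  have "emeasure gaps {\<omega>. in_state 0 s 0 \<omega> \<and> residual s 0 \<omega> \<in> B}
      = (\<integral>\<^sup>+e. emeasure gaps {\<omega>. case_nat e \<omega> \<in> {\<omega>. in_state 0 s 0 \<omega> \<and> residual s 0 \<omega> \<in> B}} \<partial>gap)"
    by (rule emeasure_gaps_first[OF residual_event_sets[OF B]])
  also have "\<dots> = (\<integral>\<^sup>+e. indicator {s<..} e * F (e - s) \<partial>gap)"
  proof (rule nn_integral_cong)
    fix e
    have "in_state 0 s 0 (case_nat e \<omega>) \<longleftrightarrow> s < e" for \<omega>
      using 0 by (auto simp: in_state_def)
    moreover have "residual s 0 (case_nat e \<omega>) = case_nat (e - s) \<omega>" for \<omega>
      by (auto simp: residual_def)
    ultimately show "emeasure gaps {\<omega>. case_nat e \<omega> \<in> {\<omega>. in_state 0 s 0 \<omega> \<and> residual s 0 \<omega> \<in> B}}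
        = indicator {s<..} e * F (e - s)"
      by (auto simp: F_def split: split_indicator)
  qed
  also have "\<dots> = ennreal (exp (- (r * s))) * (\<integral>\<^sup>+e. F e \<partial>gap)"
    by (rule nn_integral_gap_beyond) (use 0 in auto)
  also have "(\<integral>\<^sup>+e. F e \<partial>gap) = emeasure gaps B"
    unfolding F_def by (rule emeasure_gaps_first[symmetric]) fact
  finally show ?case by (simp add: poisson_weight_def)
next
  case (Suc m)
  let ?A = "{\<omega>. in_state 0 s (Suc m) \<omega> \<and> residual s (Suc m) \<omega> \<in> B}"
  have "emeasure gaps ?A = (\<integral>\<^sup>+e. emeasure gaps {\<omega>. case_nat e \<omega> \<in> ?A} \<partial>gap)"
    by (rule emeasure_gaps_first[OF residual_event_sets[OF B]])
  also have "\<dots> = (\<integral>\<^sup>+e. (indicator {..s} e * ennreal (poisson_weight m (r * (s - e)))) * emeasure gaps B \<partial>gap)"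
  proof (rule nn_integral_cong)
    fix e
    \<comment> \<open>restart at the first arrival\<close>
    have first: "{\<omega>. case_nat e \<omega> \<in> ?A} = {\<omega>. in_state 0 (s - e) m \<omega> \<and> residual (s - e) m \<omega> \<in> B}"
      unfolding mem_Collect_eq residual_case_nat by (auto simp: in_state_def)
    show "emeasure gaps {\<omega>. case_nat e \<omega> \<in> ?A}
        = (indicator {..s} e * ennreal (poisson_weight m (r * (s - e)))) * emeasure gaps B"
    proof (cases "e \<le> s")
      case True
      then show ?thesis unfolding first by (subst Suc.IH) auto
    next
      case False
      have "AE \<omega> in gaps. \<not> (in_state 0 (s - e) m \<omega> \<and> residual (s - e) m \<omega> \<in> B)"
        using AE_gaps_pos
      proof eventually_elim
        fix \<omega> :: "nat \<Rightarrow> real" assume "\<forall>i. 0 < \<omega> i"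
        then have "arrival 0 \<omega> \<le> arrival m \<omega>"
          by (intro arrival_mono) auto
        with False show "\<not> (in_state 0 (s - e) m \<omega> \<and> residual (s - e) m \<omega> \<in> B)"
          by (auto simp: in_state_def)
      qed
      then have "emeasure gaps {\<omega> \<in> space gaps. in_state 0 (s - e) m \<omega> \<and> residual (s - e) m \<omega> \<in> B} = 0"
        by (intro emeasure_eq_0_AE)
      then show ?thesis unfolding first using False by simp
    qed
  qed
  also have "\<dots> = (\<integral>\<^sup>+e. indicator {..s} e * ennreal (poisson_weight m (r * (s - e))) \<partial>gap) * emeasure gaps B"
    by (rule nn_integral_multc) measurable
  also have "\<dots> = ennreal (poisson_weight (Suc m) (r * s)) * emeasure gaps B"
    by (subst nn_integral_gap_poisson_weight) (use Suc.prems in auto)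
  finally show ?case .
qed

definition jump_prob :: "real \<Rightarrow> nat \<Rightarrow> nat \<Rightarrow> real" where
  "jump_prob \<tau> i j = (if i \<le> j then poisson_weight (j - i) (r * \<tau>) else 0)"

lemma prob_residual:
  assumes "B \<in> sets gaps" and "0 \<le> s"
  shows "measure gaps {\<omega>. in_state i s m \<omega> \<and> residual s (m - i) \<omega> \<in> B} = jump_prob s i m * measure gaps B"
proof (cases "i \<le> m")
  case True
  then have "in_state i s m \<omega> \<longleftrightarrow> in_state 0 s (m - i) \<omega>" for \<omega>
    by (auto simp: in_state_def Suc_diff_le)
  then show ?thesis
    using emeasure_residual[OF assms, of "m - i"] True r_pos \<open>0 \<le> s\<close>
    by (simp add: jump_prob_def measure_def enn2real_mult poisson_weight_nonneg)
qed (simp add: in_state_def jump_prob_def)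

lemma prob_in_state: "0 \<le> s \<Longrightarrow> measure gaps {\<omega>. in_state i s m \<omega>} = jump_prob s i m"
  using prob_residual[of UNIV s i m] sets.top[of gaps] gaps.prob_space by simp

lemma prob_states_first:
  assumes t: "0 \<le> t 0" "\<forall>l\<le>k. t l < t (Suc l)"
  shows "measure gaps {\<omega>. \<forall>l\<le>Suc k. in_state i (t l) (j l) \<omega>}
    = jump_prob (t 0) i (j 0) * measure gaps {\<omega>. \<forall>l\<le>k. in_state (j 0) (t (Suc l) - t 0) (j (Suc l)) \<omega>}"
proof -
  let ?B = "{\<omega>. \<forall>l\<le>k. in_state (j 0) (t (Suc l) - t 0) (j (Suc l)) \<omega>}"
  have "measure gaps {\<omega>. \<forall>l\<le>Suc k. in_state i (t l) (j l) \<omega>}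
      = measure gaps {\<omega>. in_state i (t 0) (j 0) \<omega> \<and> residual (t 0) (j 0 - i) \<omega> \<in> ?B}"
  proof (rule measure_eq_AE)
    show "AE \<omega> in gaps. (\<omega> \<in> {\<omega>. \<forall>l\<le>Suc k. in_state i (t l) (j l) \<omega>})
        = (\<omega> \<in> {\<omega>. in_state i (t 0) (j 0) \<omega> \<and> residual (t 0) (j 0 - i) \<omega> \<in> ?B})"
      using AE_gaps_pos
    proof eventually_elim
      fix \<omega> :: "nat \<Rightarrow> real" assume pos: "\<forall>i. 0 < \<omega> i"
      have "in_state i (t (Suc l)) (j (Suc l)) \<omega>
          \<longleftrightarrow> in_state (j 0) (t (Suc l) - t 0) (j (Suc l)) (residual (t 0) (j 0 - i) \<omega>)"
        if "in_state i (t 0) (j 0) \<omega>" "l \<le> k" for l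
        using in_state_residual[OF _ _ that(1), of "t (Suc l) - t 0" "j (Suc l)"] pos
          increasing_times_mono[OF t(2), of 0 "Suc l"] that(2) by auto
      moreover have "(\<forall>l\<le>Suc k. in_state i (t l) (j l) \<omega>)
          \<longleftrightarrow> in_state i (t 0) (j 0) \<omega> \<and> (\<forall>l\<le>k. in_state i (t (Suc l)) (j (Suc l)) \<omega>)"
        by (metis Suc_le_mono le0 not0_implies_Suc)
      ultimately show "(\<omega> \<in> {\<omega>. \<forall>l\<le>Suc k. in_state i (t l) (j l) \<omega>})
          = (\<omega> \<in> {\<omega>. in_state i (t 0) (j 0) \<omega> \<and> residual (t 0) (j 0 - i) \<omega> \<in> ?B})"
        by auto
    qed
  qed (intro residual_event_sets states_event_sets)+
  also have "\<dots> = jump_prob (t 0) i (j 0) * measure gaps ?B"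
    by (rule prob_residual[OF states_event_sets t(1)])
  finally show ?thesis .
qed

text \<open>Restarting at the first time \<open>t 0\<close> shortens the list of times by one, which makes induction
  possible; the last factor is the same for the restarted process.\<close>

theorem prob_states_Suc:
  assumes "0 \<le> t 0" "\<forall>l\<le>k. t l < t (Suc l)"
  shows "measure gaps {\<omega>. \<forall>l\<le>Suc k. in_state i (t l) (j l) \<omega>}
    = measure gaps {\<omega>. \<forall>l\<le>k. in_state i (t l) (j l) \<omega>} * jump_prob (t (Suc k) - t k) (j k) (j (Suc k))"
  using assms
proof (induction k arbitrary: i t j)
  case 0
  then show ?case
    using prob_states_first[of t 0 i j] by (simp add: prob_in_state)
next
  case (Suc k)
  note first = prob_states_first[of t _ i j, OF Suc.prems(1)]
  have "measure gaps {\<omega>. \<forall>l\<le>Suc k. in_state (j 0) (t (Suc l) - t 0) (j (Suc l)) \<omega>}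
      = measure gaps {\<omega>. \<forall>l\<le>k. in_state (j 0) (t (Suc l) - t 0) (j (Suc l)) \<omega>}
        * jump_prob ((t (Suc (Suc k)) - t 0) - (t (Suc k) - t 0)) (j (Suc k)) (j (Suc (Suc k)))"
    by (rule Suc.IH) (use Suc.prems(2) in \<open>auto intro: less_imp_le\<close>)
  then show ?case
    using first[of "Suc k"] first[of k] Suc.prems(2) by simp
qed

text \<open>The \<open>k\<close>-th arrival is later than \<open>t\<close> iff fewer than \<open>k\<close> arrivals happen up to time \<open>t\<close>.\<close>

lemma prob_arrival_gt:
  assumes "0 \<le> t"
  shows "measure gaps {\<omega>. t < arrival k \<omega>} = (\<Sum>m<k. poisson_weight m (r * t))"
proof (induction k)
  case (Suc k)
  have sets: "{\<omega>. t < arrival m \<omega>} \<in> sets gaps" "{\<omega>. in_state 0 t m \<omega>} \<in> sets gaps"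
    for m
  proof -
    have "{\<omega> \<in> space gaps. t < arrival m \<omega>} \<in> sets gaps" "{\<omega> \<in> space gaps. in_state 0 t m \<omega>} \<in> sets gaps"
      by measurable
    then show "{\<omega>. t < arrival m \<omega>} \<in> sets gaps" "{\<omega>. in_state 0 t m \<omega>} \<in> sets gaps"
      by simp_all
  qed
  have "measure gaps {\<omega>. t < arrival (Suc k) \<omega>}
      = measure gaps ({\<omega>. t < arrival k \<omega>} \<union> {\<omega>. in_state 0 t k \<omega>})"
  proof (rule measure_eq_AE)
    show "AE \<omega> in gaps. (\<omega> \<in> {\<omega>. t < arrival (Suc k) \<omega>})
        = (\<omega> \<in> {\<omega>. t < arrival k \<omega>} \<union> {\<omega>. in_state 0 t k \<omega>})"
      using AE_gaps_pos by eventually_elim (force simp: in_state_def arrival_Suc dest: spec[of _ k])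
  qed (use sets in auto)
  also have "\<dots> = measure gaps {\<omega>. t < arrival k \<omega>} + measure gaps {\<omega>. in_state 0 t k \<omega>}"
    by (rule gaps.finite_measure_Union) (use sets in \<open>auto simp: in_state_def\<close>)
  finally show ?case
    using Suc assms by (simp add: prob_in_state jump_prob_def)
qed (use assms in simp)

lemma arrival_erlang: "distributed gaps lborel (arrival (Suc k)) (erlang_density k r)"
  unfolding gaps.erlang_distributed_iff[OF r_pos]
proof (intro conjI allI impI)
  fix t :: real assume "0 \<le> t"
  have "{\<omega> \<in> space gaps. arrival (Suc k) \<omega> \<le> t} = space gaps - {\<omega>. t < arrival (Suc k) \<omega>}"
    by auto
  moreover have "{\<omega> \<in> space gaps. t < arrival (Suc k) \<omega>} \<in> sets gaps"
    by measurable
  ultimately show "measure gaps {\<omega> \<in> space gaps. arrival (Suc k) \<omega> \<le> t} = erlang_CDF k r t"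
    using \<open>0 \<le> t\<close> gaps.prob_compl[of "{\<omega>. t < arrival (Suc k) \<omega>}"]
    by (simp add: prob_arrival_gt erlang_CDF_def poisson_weight_def lessThan_Suc_atMost)
qed (use r_pos in auto)

end

section \<open>Coxian processes with a common jump rate\<close>

text \<open>\<open>Q l\<close> is the probability that the \<open>l\<close>-th jump does not terminate the process, and \<open>r\<close> is the jump
  rate.  The limit says that the process terminates almost surely.\<close>

locale coxian = poisson_arrivals r for r +
  fixes Q :: "nat \<Rightarrow> real"
  assumes Q_nonneg: "\<And>l. 0 \<le> Q l" and Q_le_1: "\<And>l. Q l \<le> 1"
    and Q_prod: "(\<lambda>k. \<Prod>m=1..k. Q m) \<longlonglongrightarrow> 0"
begin

definition rates :: "nat \<Rightarrow> nat \<Rightarrow> real" where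
  "rates i j = (if j = i then - r else if j = Suc i then r * Q (Suc i) else 0)"

text \<open>The probability that a process in state \<open>i\<close> survives the next \<open>k\<close> jumps.\<close>

definition reach :: "nat \<Rightarrow> nat \<Rightarrow> real" where
  "reach i k = (\<Prod>m\<in>{Suc i..i + k}. Q m)"

lemma reach_0 [simp]: "reach i 0 = 1"
  by (simp add: reach_def)

lemma reach_nonneg: "0 \<le> reach i k"
  unfolding reach_def by (intro prod_nonneg) (simp add: Q_nonneg)

lemma reach_le_1: "reach i k \<le> 1"
  unfolding reach_def by (intro prod_le_1) (simp add: Q_nonneg Q_le_1)

lemma abs_reach: "\<bar>reach i k\<bar> \<le> 1"
  using reach_nonneg[of i k] reach_le_1[of i k] by simp

lemma reach_add: "reach i (k + l) = reach i k * reach (i + k) l"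
proof -
  have "{Suc i..i + (k + l)} = {Suc i..i + k} \<union> {Suc (i + k)..i + k + l}"
    by auto
  then show ?thesis
    unfolding reach_def by (simp add: prod.union_disjoint)
qed

lemma reach_Suc: "reach i (Suc k) = Q (Suc i) * reach (Suc i) k"
  using reach_add[of i "Suc 0" k] by (simp add: reach_def[of i "Suc 0"])

lemma reach_Suc_last: "reach i (Suc k) = reach i k * Q (Suc (i + k))"
  using reach_add[of i k "Suc 0"] by (simp add: reach_def[of "i + k" "Suc 0"])

text \<open>The number of jumps before the terminating one.\<close>

definition lifetime :: "nat pmf" where
  "lifetime = embed_pmf (\<lambda>k. reach 0 k * (1 - Q (Suc k)))"

lemma pmf_lifetime: "pmf lifetime k = reach 0 k * (1 - Q (Suc k))"
  unfolding lifetime_def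
proof (rule pmf_embed_pmf)
  show nonneg: "0 \<le> reach 0 k * (1 - Q (Suc k))" for k
    by (simp add: reach_nonneg Q_le_1)
  have "(\<lambda>k. reach 0 k) \<longlonglongrightarrow> 0"
    using Q_prod by (simp add: reach_def)
  from telescope_sums'[OF this]
  have "(\<lambda>k. reach 0 k * (1 - Q (Suc k))) sums 1"
    by (simp add: reach_Suc_last algebra_simps)
  then show "(\<integral>\<^sup>+k. ennreal (reach 0 k * (1 - Q (Suc k))) \<partial>count_space UNIV) = 1"
    using nonneg by (simp add: nn_integral_count_space_nat suminf_ennreal2 sums_iff)
qed

lemma prob_lifetime_ge: "measure_pmf.prob lifetime {k. j \<le> k} = reach 0 j"
proof -
  have "measure_pmf.prob lifetime {..<j} = (\<Sum>k<j. reach 0 k - reach 0 (Suc k))"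
    by (simp add: measure_measure_pmf_finite pmf_lifetime reach_Suc_last algebra_simps)
  also have "\<dots> = 1 - reach 0 j"
    by (subst sum_lessThan_telescope') simp
  finally have "measure_pmf.prob lifetime (space lifetime - {..<j}) = reach 0 j"
    by (subst measure_pmf.prob_compl) auto
  also have "space lifetime - {..<j} = {k. j \<le> k}"
    by auto
  finally show ?thesis .
qed

definition outcomes :: "(nat \<times> (nat \<Rightarrow> real)) measure" where
  "outcomes = measure_pmf lifetime \<Otimes>\<^sub>M gaps"

lemma space_outcomes [simp]: "space outcomes = UNIV"
  by (simp add: outcomes_def space_pair_measure)

sublocale outcomes: prob_space outcomes
proof -
  interpret pair_prob_space "measure_pmf lifetime" gaps ..
  show "prob_space outcomes"
    unfolding outcomes_def by unfold_locales
qed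

definition time_of_death :: "nat \<times> (nat \<Rightarrow> real) \<Rightarrow> real" where
  "time_of_death p = arrival (Suc (fst p)) (snd p)"

definition process :: "real \<Rightarrow> nat \<times> (nat \<Rightarrow> real) \<Rightarrow> nat option" where
  "process t p =
     (if t < time_of_death p then Some (LEAST m. t < arrival (Suc m) (snd p)) else None)"

lemma fst_measurable_outcomes [measurable]: "fst \<in> measurable outcomes (count_space UNIV)"
  using measurable_fst[of "measure_pmf lifetime" gaps] by (simp add: outcomes_def)

lemma snd_measurable_outcomes [measurable]: "snd \<in> measurable outcomes gaps"
  unfolding outcomes_def by measurable

lemma time_of_death_measurable [measurable]: "time_of_death \<in> borel_measurable outcomes"
  unfolding time_of_death_def[abs_def]
  by (rule measurable_compose_countable[where f = "\<lambda>k p. arrival (Suc k) (snd p)"]) measurable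

lemma process_measurable [measurable]: "process t \<in> measurable outcomes (count_space UNIV)"
  unfolding process_def[abs_def] by measurable

lemma AE_outcomes_pos: "AE p in outcomes. \<forall>i. 0 < snd p i"
proof -
  interpret pair_sigma_finite "measure_pmf lifetime" gaps ..
  have meas: "(\<lambda>p. snd p i) \<in> borel_measurable outcomes" for i
  proof -
    have "(\<lambda>\<omega>. \<omega> i) \<in> borel_measurable gaps" by measurable
    from measurable_compose[OF snd_measurable_outcomes this] show ?thesis .
  qed
  have "AE p in outcomes. 0 < snd p i" for i
    unfolding outcomes_def
  proof (rule AE_pair_measure)
    show "{p \<in> space (measure_pmf lifetime \<Otimes>\<^sub>M gaps). 0 < snd p i} \<in> sets (measure_pmf lifetime \<Otimes>\<^sub>M gaps)"
      using meas[of i] unfolding outcomes_def[symmetric] by measurable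
    show "AE k in measure_pmf lifetime. AE \<omega> in gaps. 0 < snd (k, \<omega>) i"
      using AE_gaps_pos by (auto elim: eventually_mono)
  qed
  then show ?thesis by (simp add: AE_all_countable)
qed

lemma process_None: "process t p = None \<longleftrightarrow> time_of_death p \<le> t"
  by (auto simp: process_def)

lemma process_Some:
  assumes pos: "\<And>i. 0 < snd p i" and "0 \<le> t"
  shows "process t p = Some m \<longleftrightarrow> m \<le> fst p \<and> in_state 0 t m (snd p)"
proof
  assume "process t p = Some m"
  then have t: "t < arrival (Suc (fst p)) (snd p)" and m: "m = (LEAST m. t < arrival (Suc m) (snd p))"
    by (auto simp: process_def time_of_death_def split: if_splits)
  have "m \<le> fst p" "t < arrival (Suc m) (snd p)"
    unfolding m using t by (rule Least_le, rule LeastI)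
  moreover have "arrival m (snd p) \<le> t"
    using not_less_Least[of "m - 1" "\<lambda>m. t < arrival (Suc m) (snd p)"] \<open>0 \<le> t\<close>
    unfolding m[symmetric] by (cases m) auto
  ultimately show "m \<le> fst p \<and> in_state 0 t m (snd p)"
    by (simp add: in_state_def)
next
  assume m: "m \<le> fst p \<and> in_state 0 t m (snd p)"
  then have "t < time_of_death p"
    using arrival_mono[of "snd p" "Suc m" "Suc (fst p)"] pos
    by (simp add: in_state_def time_of_death_def)
  moreover have "(LEAST m. t < arrival (Suc m) (snd p)) = m"
  proof (rule Least_equality)
    fix m' assume "t < arrival (Suc m') (snd p)"
    then show "m \<le> m'"
      using arrival_mono[of "snd p" "Suc m'" m] pos m by (force simp: in_state_def not_le Suc_le_eq)
  qed (use m in \<open>simp add: in_state_def\<close>)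
  ultimately show "process t p = Some m"
    by (simp add: process_def)
qed

text \<open>The counting process is nondecreasing, so being alive at the last of the times is being alive
  at all of them.  The event is therefore, up to a null set, a rectangle in the lifetime and the
  waiting times.\<close>

lemma prob_alive_states:
  fixes k :: nat
  assumes t: "\<And>l. l \<le> k \<Longrightarrow> 0 \<le> t l" "\<And>l. l \<le> k \<Longrightarrow> t l \<le> t k"
  shows "measure outcomes {p \<in> space outcomes. \<forall>l\<le>k. process (t l) p = Some (j l)}
    = reach 0 (j k) * measure gaps {\<omega>. \<forall>l\<le>k. in_state 0 (t l) (j l) \<omega>}"
proof -
  let ?A = "{k'. j k \<le> k'}" and ?B = "{\<omega>. \<forall>l\<le>k. in_state 0 (t l) (j l) \<omega>}"
  have rect: "?A \<times> ?B \<in> sets outcomes"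
    unfolding outcomes_def by (rule pair_measureI[OF _ states_event_sets]) simp
  have "measure outcomes {p \<in> space outcomes. \<forall>l\<le>k. process (t l) p = Some (j l)} = measure outcomes (?A \<times> ?B)"
  proof (rule measure_eq_AE)
    show "AE p in outcomes. (p \<in> {p \<in> space outcomes. \<forall>l\<le>k. process (t l) p = Some (j l)}) = (p \<in> ?A \<times> ?B)"
      using AE_outcomes_pos
    proof eventually_elim
      fix p :: "nat \<times> (nat \<Rightarrow> real)" assume pos: "\<forall>i. 0 < snd p i"
      have "j l \<le> fst p" if "j k \<le> fst p" "\<forall>l\<le>k. in_state 0 (t l) (j l) (snd p)" "l \<le> k" for l
      proof (rule ccontr)
        assume "\<not> j l \<le> fst p"
        then have "arrival (Suc (j k)) (snd p) \<le> arrival (j l) (snd p)"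
          using pos that by (intro arrival_mono) auto
        moreover have "arrival (j l) (snd p) \<le> t l" "t k < arrival (Suc (j k)) (snd p)"
          using that by (auto simp: in_state_def)
        ultimately show False using t(2)[OF that(3)] by simp
      qed
      then show "(p \<in> {p \<in> space outcomes. \<forall>l\<le>k. process (t l) p = Some (j l)}) = (p \<in> ?A \<times> ?B)"
        using pos t(1) by (cases p) (auto simp: process_Some)
    qed
    show "{p \<in> space outcomes. \<forall>l\<le>k. process (t l) p = Some (j l)} \<in> sets outcomes"
      by (intro finite_dimensional_event_sets process_measurable)
  qed (rule rect)
  also have "\<dots> = measure_pmf.prob lifetime ?A * measure gaps ?B"
    unfolding outcomes_def measure_def
    by (subst gaps.emeasure_pair_measure_Times) (auto simp: enn2real_mult states_event_sets)
  finally show ?thesis by (simp add: prob_lifetime_ge)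
qed

lemma prob_process:
  assumes "0 \<le> t"
  shows "measure outcomes {p \<in> space outcomes. process t p = Some j} = reach 0 j * jump_prob t 0 j"
  using prob_alive_states[of 0 "\<lambda>_. t" "\<lambda>_. j"] assms by (simp add: prob_in_state)

text \<open>Each path has only finitely many jumps, because it is absorbed at the jump number \<open>fst p + 1\<close>;
  between consecutive arrivals it is constant.\<close>

lemma jump_path_process: "AE p in outcomes. jump_path (\<lambda>t. process t p)"
  using AE_outcomes_pos
proof eventually_elim
  fix p :: "nat \<times> (nat \<Rightarrow> real)" assume pos: "\<forall>i. 0 < snd p i"
  have arrival_nonneg: "0 \<le> arrival m (snd p)" for m
    using arrival_mono[of "snd p" 0 m] pos by simp
  show "jump_path (\<lambda>t. process t p)"
  proof (rule jump_pathI)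
    fix t :: real assume "0 \<le> t"
    show "\<exists>b>t. \<forall>u. t < u \<and> u < b \<longrightarrow> process u p = process t p"
    proof (cases "process t p")
      case None
      then show ?thesis
        by (intro exI[of _ "t + 1"]) (auto simp: process_def)
    next
      case (Some m)
      then have m: "m \<le> fst p" "in_state 0 t m (snd p)"
        using pos \<open>0 \<le> t\<close> by (simp_all add: process_Some)
      then have "process u p = Some m" if "t < u" "u < arrival (Suc m) (snd p)" for u
        using that pos \<open>0 \<le> t\<close> by (subst process_Some) (auto simp: in_state_def)
      then show ?thesis
        using m Some by (intro exI[of _ "arrival (Suc m) (snd p)"]) (auto simp: in_state_def)
    qed
  next
    fix t :: real assume "0 < t"
    show "\<exists>a<t. \<exists>y. \<forall>u. a < u \<and> u < t \<longrightarrow> process u p = y"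
    proof (cases "t \<le> time_of_death p")
      case False
      then show ?thesis
        by (intro exI[of _ "time_of_death p"] conjI exI[of _ None]) (auto simp: process_def)
    next
      case True
      define m where "m = (LEAST m. t \<le> arrival (Suc m) (snd p))"
      have m: "m \<le> fst p" "t \<le> arrival (Suc m) (snd p)"
        unfolding m_def using True unfolding time_of_death_def by (rule Least_le, rule LeastI)
      have "arrival m (snd p) < t"
        using not_less_Least[of "m - 1" "\<lambda>m. t \<le> arrival (Suc m) (snd p)"] \<open>0 < t\<close>
        unfolding m_def[symmetric] by (cases m) auto
      moreover have "process u p = Some m" if "arrival m (snd p) < u" "u < t" for u
        using that pos m arrival_nonneg[of m] by (subst process_Some) (auto simp: in_state_def)
      ultimately show ?thesis
        by (intro exI[of _ "arrival m (snd p)"] conjI exI[of _ "Some m"]) auto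
    qed
  qed
qed

text \<open>The \<open>k\<close>-step transition probabilities of the embedded jump chain, which rests once it is absorbed.\<close>

definition after :: "nat \<Rightarrow> nat option \<Rightarrow> nat option \<Rightarrow> real" where
  "after k x y =
     (case x of None \<Rightarrow> of_bool (y = None)
      | Some i \<Rightarrow> (case y of None \<Rightarrow> 1 - reach i k | Some j \<Rightarrow> if j = i + k then reach i k else 0))"

lemma after_nonneg: "0 \<le> after k x y" and after_le_1: "after k x y \<le> 1"
  using reach_nonneg reach_le_1 by (auto simp: after_def split: option.split)

lemma abs_after: "\<bar>after k x y\<bar> \<le> 1"
  using after_nonneg[of k x y] after_le_1[of k x y] by simp

lemma after_0: "after 0 x y = of_bool (x = y)"
  by (auto simp: after_def split: option.split)

lemma after_Suc:
  "after (Suc k) (Some i) y = Q (Suc i) * after k (Some (Suc i)) y + (1 - Q (Suc i)) * after k None y"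
  by (auto simp: after_def reach_Suc algebra_simps split: option.split)

text \<open>Uniformization: the number of arrivals in an interval of length \<open>t - s\<close> is Poisson distributed with
  mean \<open>r * (t - s)\<close>, whatever the state is.\<close>

definition transition :: "real \<Rightarrow> real \<Rightarrow> nat option \<Rightarrow> nat option \<Rightarrow> real" where
  "transition s t x y = poisson_average (\<lambda>k. after k x y) (r * (t - s))"

lemma transition_None: "transition s t None y = of_bool (y = None)"
  by (simp add: transition_def after_def poisson_average_const)

lemma transition_Some_Some: "transition s t (Some i) (Some j) = jump_prob (t - s) i j * reach i (j - i)"
proof (cases "i \<le> j")
  case True
  then have "transition s t (Some i) (Some j)
      = (\<Sum>k\<in>{j - i}. poisson_weight k (r * (t - s)) * after k (Some i) (Some j))"
    unfolding transition_def poisson_average_def by (intro suminf_finite) (auto simp: after_def)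
  then show ?thesis using True by (simp add: jump_prob_def after_def)
next
  case False
  then have "(\<lambda>k. after k (Some i) (Some j)) = (\<lambda>k. 0)"
    by (auto simp: after_def)
  then show ?thesis using False by (simp add: transition_def poisson_average_const jump_prob_def)
qed

lemma transition_Some_None:
  assumes "s \<le> t"
  shows "transition s t (Some i) None = 1 - poisson_average (reach i) (r * (t - s))"
  using poisson_average_linear[of "\<lambda>k. 1" 1 "reach i" 1 "r * (t - s)" 1 "- 1"] abs_reach assms r_pos
  by (simp add: transition_def after_def poisson_average_const)

lemma probability_vector_transition:
  assumes "s \<le> t"
  shows "probability_vector (transition s t x)"
  unfolding probability_vector_def
proof (intro conjI allI)
  have time: "0 \<le> r * (t - s)"
    using assms r_pos by simp
  show "0 \<le> transition s t x y" for y
    unfolding transition_def using after_nonneg after_le_1 time by (intro poisson_average_nonneg)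
  show "(transition s t x has_sum 1) UNIV"
  proof (cases x)
    case None
    then show ?thesis
      by (intro has_sum_finite_neutralI[of "{None}"]) (auto simp: transition_None)
  next
    case (Some i)
    define p where "p = poisson_average (reach i) (r * (t - s))"
    have "(\<lambda>k. poisson_weight k (r * (t - s)) * reach i k) sums p"
      unfolding p_def poisson_average_def
      by (intro summable_sums summable_poisson_average[of _ 1] abs_reach time)
    then have "((\<lambda>k. poisson_weight k (r * (t - s)) * reach i k) has_sum p) UNIV"
      by (intro sums_nonneg_imp_has_sum) (auto simp: poisson_weight_nonneg reach_nonneg time)
    also have "(\<lambda>k. poisson_weight k (r * (t - s)) * reach i k) = transition s t x \<circ> (\<lambda>k. Some (i + k))"
      by (auto simp: Some transition_Some_Some jump_prob_def)
    finally have "(transition s t x has_sum p) (range (\<lambda>k. Some (i + k)))"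
      by (subst has_sum_reindex) (auto simp: inj_on_def comp_def)
    then have "(transition s t x has_sum (transition s t x None + p)) (insert None (range (\<lambda>k. Some (i + k))))"
      by (intro has_sum_insert) auto
    moreover have "transition s t x None + p = 1"
      using assms by (simp add: Some transition_Some_None p_def)
    ultimately have "(transition s t x has_sum 1) (insert None (range (\<lambda>k. Some (i + k))))"
      by simp
    then show ?thesis
    proof (rule has_sum_cong_neutral[THEN iffD1, rotated -1])
      fix y assume y: "y \<in> UNIV - insert None (range (\<lambda>k. Some (i + k)))"
      then obtain j where "y = Some j" by auto
      moreover have "j < i"
      proof (rule ccontr)
        assume "\<not> j < i"
        then have "y = Some (i + (j - i))" using \<open>y = Some j\<close> by simp
        then show False using y by blast
      qed
      ultimately show "transition s t x y = 0"
        by (simp add: Some transition_Some_Some jump_prob_def)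
    qed auto
  qed
qed

lemma rates_row_sum: "(rates i has_sum (r * Q (Suc i) - r)) UNIV"
  by (rule has_sum_finite_neutralI[of "{i, Suc i}"]) (auto simp: rates_def)

lemma full_intensity_row_sum:
  "(\<Sum>\<^sub>\<infinity>z. full_intensity rates (Some i) z * g z)
    = r * (Q (Suc i) * g (Some (Suc i)) + (1 - Q (Suc i)) * g None - g (Some i))"
proof (rule infsumI, rule has_sum_finite_neutralI[of "{Some i, Some (Suc i), None}"])
  have to_None: "full_intensity rates (Some i) None = r * (1 - Q (Suc i))"
    unfolding full_intensity_def by (simp add: infsumI[OF rates_row_sum[of i]] algebra_simps)
  show "r * (Q (Suc i) * g (Some (Suc i)) + (1 - Q (Suc i)) * g None - g (Some i))
      = (\<Sum>z\<in>{Some i, Some (Suc i), None}. full_intensity rates (Some i) z * g z)"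
    by (simp add: to_None full_intensity_def[of _ "Some i" "Some _"] rates_def algebra_simps)
  fix z assume "z \<in> UNIV - {Some i, Some (Suc i), None}"
  then show "full_intensity rates (Some i) z * g z = 0"
    by (cases z) (auto simp: full_intensity_def rates_def)
qed auto

text \<open>The generator is \<open>r\<close> times the one-step transition matrix of the jump chain minus the identity,
  and applying the one-step matrix to the \<open>k\<close>-step one gives the \<open>(k + 1)\<close>-step one.\<close>

lemma backward_row:
  assumes "u \<le> t"
  shows "(\<Sum>\<^sub>\<infinity>z. full_intensity rates x z * transition u t z y)
    = r * (poisson_average (\<lambda>k. after (Suc k) x y) (r * (t - u)) - poisson_average (\<lambda>k. after k x y) (r * (t - u)))"
proof (cases x)
  case None
  have "after (Suc k) None y = after k None y" for k
    by (simp add: after_def)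
  then show ?thesis by (simp add: None full_intensity_def)
next
  case (Some i)
  have "poisson_average (\<lambda>k. after (Suc k) (Some i) y) (r * (t - u))
      = Q (Suc i) * transition u t (Some (Suc i)) y + (1 - Q (Suc i)) * transition u t None y"
    unfolding after_Suc transition_def
    by (rule poisson_average_linear[of _ 1 _ 1]) (use abs_after assms r_pos in auto)
  then show ?thesis
    unfolding Some full_intensity_row_sum by (simp add: transition_def)
qed

lemma transition_function_transition: "transition_function (\<lambda>t. rates) transition"
  unfolding transition_function_def
proof (intro allI impI conjI)
  fix s t :: real and x assume "0 \<le> s \<and> s \<le> t"
  then show "probability_vector (transition s t x)"
    by (intro probability_vector_transition) simp
next
  fix s t :: real and x y assume st: "0 \<le> s \<and> s \<le> t"
  define c where "c k = after k x y" for k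
  define G where "G u = r * (poisson_average (\<lambda>k. c (Suc k)) (r * (t - u)) - poisson_average c (r * (t - u)))" for u
  have c: "\<bar>c k\<bar> \<le> 1" for k
    by (simp add: c_def abs_after)
  have deriv: "((\<lambda>u. - poisson_average c (r * (t - u))) has_real_derivative G u) (at u)" for u
  proof -
    have "((\<lambda>u. poisson_average c (r * (t - u))) has_real_derivative
        (poisson_average (\<lambda>k. c (Suc k)) (r * (t - u)) - poisson_average c (r * (t - u))) * (- r)) (at u)"
      by (rule DERIV_chain2[OF has_derivative_poisson_average[OF c]]) (auto intro!: derivative_eq_intros)
    from DERIV_minus[OF this] show ?thesis by (simp add: G_def algebra_simps)
  qed
  have cont: "isCont (\<lambda>u. poisson_average d (r * (t - u))) u" if "\<And>k. \<bar>d k\<bar> \<le> 1" for d u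
    by (rule isCont_o2[OF _ DERIV_isCont[OF has_derivative_poisson_average[OF that]]]) (intro continuous_intros)
  have isCont: "isCont G u" for u
    unfolding G_def by (intro continuous_intros cont c)
  have FTC: "has_bochner_integral lborel (\<lambda>u. G u * indicator {s..t} u)
      (- poisson_average c (r * (t - t)) - - poisson_average c (r * (t - s)))"
    using st by (intro has_bochner_integral_FTC_Icc_real deriv isCont) auto
  have row: "(\<Sum>\<^sub>\<infinity>z. full_intensity rates x z * transition u t z y) = G u" if "u \<in> {s..t}" for u
    using that by (simp add: backward_row G_def c_def[abs_def])
  have "integrable lborel (\<lambda>u. G u * indicator {s..t} u)"
    using FTC by (simp add: has_bochner_integral_iff)
  then have "set_integrable lborel {s..t} G"
    by (simp add: set_integrable_def mult.commute)
  then show "set_integrable lborel {s..t} (\<lambda>u. \<Sum>\<^sub>\<infinity>z. full_intensity rates x z * transition u t z y)"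
    using row by (subst set_integrable_cong[OF refl refl row]) auto
  have "(LBINT u:{s..t}. \<Sum>\<^sub>\<infinity>z. full_intensity rates x z * transition u t z y) = (LBINT u:{s..t}. G u)"
    by (rule set_lebesgue_integral_cong) (use row in auto)
  also have "\<dots> = transition s t x y - c 0"
    using has_bochner_integral_integral_eq[OF FTC]
    by (simp add: set_lebesgue_integral_def mult.commute poisson_average_at_0 transition_def c_def[abs_def])
  finally show "transition s t x y = of_bool (x = y) +
      (LBINT u:{s..t}. \<Sum>\<^sub>\<infinity>z. full_intensity rates x z * transition u t z y)"
    by (simp add: c_def after_0)
qed

lemma subintensity_rates: "subintensity rates"
  unfolding subintensity_def
proof (intro conjI allI impI)
  show "0 \<le> rates i j" if "i \<noteq> j" for i j
    using that r_pos by (auto simp: rates_def Q_nonneg)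
  show "rates i summable_on UNIV" for i
    using rates_row_sum by (rule has_sum_imp_summable)
  show "(\<Sum>\<^sub>\<infinity>j. rates i j) \<le> 0" for i
    using infsumI[OF rates_row_sum[of i]] Q_le_1[of "Suc i"] r_pos mult_left_mono[of "Q (Suc i)" 1 r] by simp
qed

theorem markov_jump_process_coxian:
  "markov_jump_process outcomes process (\<lambda>i. if i = 0 then 1 else 0) (\<lambda>t. rates)"
proof (rule markov_jump_processI[OF outcomes.prob_space_axioms _ subintensity_rates process_measurable
      jump_path_process _ transition_function_transition transition_None])
  have "((\<lambda>i. if i = 0 then 1 else 0) has_sum (1 :: real)) (UNIV :: nat set)"
    by (rule has_sum_finite_neutralI[of "{0}"]) auto
  then show "probability_vector (\<lambda>i::nat. if i = 0 then 1 else 0)"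
    by (auto simp: probability_vector_def)
  show "measure outcomes {p \<in> space outcomes. process 0 p = Some i} = (if i = 0 then 1 else 0)" for i
    by (simp add: prob_process[simplified] jump_prob_def poisson_weight_at_0)
  show "process t p = None" if "s \<le> t" "process s p = None" for p s t
    using that by (simp add: process_None)
  fix k :: nat and t :: "nat \<Rightarrow> real" and j
  assume t: "0 \<le> t 0" "\<forall>l\<le>k. t l < t (Suc l)"
  have times: "0 \<le> t l" "t l \<le> t m" if "l \<le> m" "m \<le> Suc k" for l m
    using increasing_times_nonneg[OF t, of l] increasing_times_mono[OF t(2), of l m] that by auto
  have step: "reach 0 (j (Suc k)) = reach 0 (j k) * reach (j k) (j (Suc k) - j k)" if "j k \<le> j (Suc k)"
    using reach_add[of 0 "j k" "j (Suc k) - j k"] that by simp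
  have "measure outcomes {p \<in> space outcomes. \<forall>l\<le>Suc k. process (t l) p = Some (j l)}
      = reach 0 (j (Suc k)) * measure gaps {\<omega>. \<forall>l\<le>Suc k. in_state 0 (t l) (j l) \<omega>}"
    by (rule prob_alive_states) (use times in auto)
  also have "\<dots> = reach 0 (j (Suc k)) * (measure gaps {\<omega>. \<forall>l\<le>k. in_state 0 (t l) (j l) \<omega>}
      * jump_prob (t (Suc k) - t k) (j k) (j (Suc k)))"
    by (subst prob_states_Suc[OF t]) simp
  also have "\<dots> = (reach 0 (j k) * measure gaps {\<omega>. \<forall>l\<le>k. in_state 0 (t l) (j l) \<omega>})
      * transition (t k) (t (Suc k)) (Some (j k)) (Some (j (Suc k)))"
    using step by (auto simp: transition_Some_Some jump_prob_def)
  also have "reach 0 (j k) * measure gaps {\<omega>. \<forall>l\<le>k. in_state 0 (t l) (j l) \<omega>}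
      = measure outcomes {p \<in> space outcomes. \<forall>l\<le>k. process (t l) p = Some (j l)}"
    by (rule prob_alive_states[symmetric]) (use times in auto)
  finally show "measure outcomes {p \<in> space outcomes. \<forall>l\<le>Suc k. process (t l) p = Some (j l)}
      = measure outcomes {p \<in> space outcomes. \<forall>l\<le>k. process (t l) p = Some (j l)}
        * transition (t k) (t (Suc k)) (Some (j k)) (Some (j (Suc k)))" .
qed

definition law :: "real measure" where
  "law = distr outcomes borel time_of_death"

lemma real_distribution_law: "real_distribution law"
  unfolding law_def by (intro outcomes.real_distribution_distr) simp

theorem infinite_phase_type_law: "infinite_phase_type (\<lambda>i. if i = 0 then 1 else 0) rates law"
  unfolding infinite_phase_type_def law_def
proof (rule termination_lawI[OF markov_jump_process_coxian time_of_death_measurable])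
  show "AE p in outcomes. termination_time process p = ereal (time_of_death p)"
    using AE_outcomes_pos
  proof eventually_elim
    fix p :: "nat \<times> (nat \<Rightarrow> real)" assume "\<forall>i. 0 < snd p i"
    then have "0 \<le> time_of_death p"
      using arrival_mono[of "snd p" 0 "Suc (fst p)"] by (simp add: time_of_death_def)
    then show "termination_time process p = ereal (time_of_death p)"
      by (intro termination_timeI process_None)
  qed
  \<comment> \<open>the lifetime is coded as the first entry, in front of the waiting times\<close>
  show "(\<lambda>p. case_nat (real (fst p)) (snd p)) \<in> measurable outcomes (PiM UNIV (\<lambda>i::nat. borel))"
  proof (rule measurable_PiM_single')
    fix i :: nat
    show "(\<lambda>p. case_nat (real (fst p)) (snd p) i) \<in> borel_measurable outcomes"
    proof (cases i)
      case 0
      then show ?thesis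
        using measurable_compose[OF fst_measurable_outcomes, of real borel] by simp
    next
      case (Suc i')
      have "(\<lambda>\<omega>. \<omega> i') \<in> borel_measurable gaps" by measurable
      from measurable_compose[OF snd_measurable_outcomes this] show ?thesis
        by (simp add: Suc)
    qed
  qed auto
  show "(\<lambda>\<omega>. (nat \<lfloor>\<omega> 0\<rfloor>, \<lambda>i. \<omega> (Suc i))) \<in> measurable (PiM UNIV (\<lambda>i::nat. borel)) outcomes"
    unfolding outcomes_def
  proof (rule measurable_Pair)
    have "(\<lambda>x::real. nat \<lfloor>x\<rfloor>) \<in> measurable borel (count_space UNIV)"
      by (rule measurable_compose[OF measurable_real_floor]) simp
    from measurable_compose[OF measurable_component_singleton[of 0 UNIV "\<lambda>i::nat. borel :: real measure", OF UNIV_I] this]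
    have "(\<lambda>\<omega>. nat \<lfloor>\<omega> 0\<rfloor>) \<in> measurable (PiM UNIV (\<lambda>i::nat. borel :: real measure)) (count_space UNIV)" .
    then show "(\<lambda>\<omega>. nat \<lfloor>\<omega> 0\<rfloor>) \<in> measurable (PiM UNIV (\<lambda>i::nat. borel :: real measure)) (measure_pmf lifetime)"
      by simp
    have "(\<lambda>\<omega> i. \<omega> (Suc i)) \<in> measurable (PiM UNIV (\<lambda>i::nat. borel :: real measure)) (PiM UNIV (\<lambda>i::nat. borel))"
      by (rule measurable_PiM_single') auto
    then show "(\<lambda>\<omega> i. \<omega> (Suc i)) \<in> measurable (PiM UNIV (\<lambda>i::nat. borel)) gaps"
      by (simp add: measurable_cong_sets[OF refl sets_gaps])
  qed
qed auto

text \<open>The process is alive at time \<open>t\<close> iff it survives all jumps up to time \<open>t\<close>.\<close>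

lemma cdf_law:
  assumes "0 \<le> t"
  shows "cdf law t = 1 - poisson_average (reach 0) (r * t)"
proof -
  let ?m = "\<lambda>y. measure outcomes (space outcomes \<inter> {p \<in> space outcomes. process t p = y})"
  have "?m None = transition 0 t (Some 0) None"
  proof (rule has_sum_option_determined)
    show "(?m has_sum 1) UNIV"
      using outcomes.has_sum_measure_partition[OF process_measurable[of t] sets.top] outcomes.prob_space by simp
    show "(transition 0 t (Some 0) has_sum 1) UNIV"
      using probability_vector_transition[OF assms] by (simp add: probability_vector_def)
    show "?m (Some j) = transition 0 t (Some 0) (Some j)" for j
      using prob_process[OF assms, of j] by (simp add: transition_Some_Some mult.commute)
  qed
  moreover have "time_of_death -` {..t} \<inter> space outcomes = space outcomes \<inter> {p \<in> space outcomes. process t p = None}"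
    by (auto simp: process_None)
  ultimately show ?thesis
    using assms by (simp add: cdf_def law_def measure_distr transition_Some_None)
qed

definition coxian_density :: "real \<Rightarrow> real" where
  "coxian_density y = (\<Sum>k. ((1 - Q (Suc k)) * (\<Prod>m=1..k. Q m)) * (y ^ k / fact k) * r ^ Suc k * exp (- (r * y)))"

text \<open>Given the lifetime \<open>k\<close>, the termination time is the arrival \<open>k + 1\<close>, which has the Erlang
  density; averaging over the lifetime gives the mixture.\<close>

theorem law_eq_density: "law = density lborel (\<lambda>y. ennreal (if 0 \<le> y then coxian_density y else 0))"
proof (rule measure_eqI)
  fix A assume "A \<in> sets law"
  then have A [measurable]: "A \<in> sets borel" by (simp add: law_def)
  have weights: "ennreal (coxian_density y) = (\<Sum>k. ennreal (pmf lifetime k) * ennreal (erlang_density k r y))"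
    if "0 \<le> y" for y
  proof -
    have eq: "pmf lifetime k * erlang_density k r y
        = ((1 - Q (Suc k)) * (\<Prod>m=1..k. Q m)) * (y ^ k / fact k) * r ^ Suc k * exp (- (r * y))" for k
      using that by (simp add: pmf_lifetime erlang_density_def reach_def)
    have eq': "pmf lifetime k * erlang_density k r y = r * (poisson_weight k (r * y) * pmf lifetime k)" for k
      using that by (simp add: erlang_density_def poisson_weight_def power_mult_distrib)
    have "summable (\<lambda>k. pmf lifetime k * erlang_density k r y)"
      unfolding eq' using that r_pos by (intro summable_mult summable_poisson_average[of _ 1]) (auto simp: pmf_le_1)
    moreover have "coxian_density y = (\<Sum>k. pmf lifetime k * erlang_density k r y)"
      by (simp only: coxian_density_def eq)
    ultimately show ?thesis
      using r_pos by (simp add: ennreal_mult'[symmetric] suminf_ennreal2)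
  qed
  have arrival_law: "emeasure gaps {\<omega>. arrival (Suc k) \<omega> \<in> A} = (\<integral>\<^sup>+y. ennreal (erlang_density k r y) * indicator A y \<partial>lborel)" for k
    using distributed_emeasure[OF arrival_erlang, of A k] A by (simp add: vimage_def)
  have rect: "{p \<in> space outcomes. time_of_death p \<in> A} \<in> sets (measure_pmf lifetime \<Otimes>\<^sub>M gaps)"
    unfolding outcomes_def[symmetric] by measurable
  have "emeasure law A = emeasure (measure_pmf lifetime \<Otimes>\<^sub>M gaps) {p \<in> space outcomes. time_of_death p \<in> A}"
    by (simp add: law_def emeasure_distr vimage_def outcomes_def[symmetric])
  also have "\<dots> = (\<integral>\<^sup>+k. emeasure gaps {\<omega>. arrival (Suc k) \<omega> \<in> A} \<partial>measure_pmf lifetime)"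
    by (subst gaps.emeasure_pair_measure_alt[OF rect]) (simp add: vimage_def time_of_death_def)
  also have "\<dots> = (\<Sum>k. ennreal (pmf lifetime k) * (\<integral>\<^sup>+y. ennreal (erlang_density k r y) * indicator A y \<partial>lborel))"
    by (simp add: arrival_law nn_integral_measure_pmf nn_integral_count_space_nat)
  also have "\<dots> = (\<Sum>k. \<integral>\<^sup>+y. ennreal (pmf lifetime k) * (ennreal (erlang_density k r y) * indicator A y) \<partial>lborel)"
    by (simp add: nn_integral_cmult)
  also have "\<dots> = (\<integral>\<^sup>+y. (\<Sum>k. ennreal (pmf lifetime k) * (ennreal (erlang_density k r y) * indicator A y)) \<partial>lborel)"
    by (rule nn_integral_suminf[symmetric]) measurable
  also have "\<dots> = (\<integral>\<^sup>+y. ennreal (if 0 \<le> y then coxian_density y else 0) * indicator A y \<partial>lborel)"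
  proof (rule nn_integral_cong)
    fix y :: real
    have "(\<Sum>k. ennreal (pmf lifetime k) * (ennreal (erlang_density k r y) * indicator A y))
        = (\<Sum>k. ennreal (pmf lifetime k) * ennreal (erlang_density k r y)) * indicator A y"
      by (subst ennreal_suminf_multc[symmetric]) (simp add: mult.assoc)
    then show "(\<Sum>k. ennreal (pmf lifetime k) * (ennreal (erlang_density k r y) * indicator A y))
        = ennreal (if 0 \<le> y then coxian_density y else 0) * indicator A y"
      using weights[of y] by (cases "0 \<le> y") (auto simp: erlang_density_def)
  qed
  also have "\<dots> = emeasure (density lborel (\<lambda>y. ennreal (if 0 \<le> y then coxian_density y else 0))) A"
  proof (rule emeasure_density[symmetric])
    have [measurable]: "coxian_density \<in> borel_measurable borel"
      unfolding coxian_density_def[abs_def] by measurable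
    show "(\<lambda>y. ennreal (if 0 \<le> y then coxian_density y else 0)) \<in> borel_measurable lborel"
      by measurable
  qed simp
  finally show "emeasure law A = emeasure (density lborel (\<lambda>y. ennreal (if 0 \<le> y then coxian_density y else 0))) A" .
qed (simp add: law_def)

end

section \<open>Moments of arrival times and cumulative hazards\<close>

context poisson_arrivals
begin

lemma erlang_density_eq: "0 \<le> s \<Longrightarrow> erlang_density k r s = r * poisson_weight k (r * s)"
  by (simp add: erlang_density_def poisson_weight_def power_mult_distrib)

lemma has_bochner_integral_poisson_weight:
  "has_bochner_integral lborel (\<lambda>s. indicator {0..} s * poisson_weight k (r * s)) (1 / r)"
proof (rule has_bochner_integral_nn_integral)
  have "(\<integral>\<^sup>+s. ennreal (indicator {0..} s * poisson_weight k (r * s)) \<partial>lborel)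
      = (\<integral>\<^sup>+s. ennreal (1 / r) * ennreal (erlang_density k r s * s ^ 0) \<partial>lborel)"
  proof (rule nn_integral_cong)
    fix s :: real
    show "ennreal (indicator {0..} s * poisson_weight k (r * s)) = ennreal (1 / r) * ennreal (erlang_density k r s * s ^ 0)"
    proof (cases "0 \<le> s")
      case True
      then show ?thesis
        using r_pos by (simp add: erlang_density_eq ennreal_mult'[symmetric])
    qed (simp add: erlang_density_def)
  qed
  also have "\<dots> = ennreal (1 / r)"
    using nn_integral_erlang_ith_moment[OF r_pos, of k 0] r_pos by (simp add: nn_integral_cmult)
  finally show "(\<integral>\<^sup>+s. ennreal (indicator {0..} s * poisson_weight k (r * s)) \<partial>lborel) = ennreal (1 / r)" .
qed (use r_pos in \<open>auto simp: poisson_weight_nonneg split: split_indicator\<close>)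

lemma arrival_square_deviation:
  shows "integrable gaps (\<lambda>\<omega>. (arrival k \<omega> - t)\<^sup>2)"
    and "gaps.expectation (\<lambda>\<omega>. (arrival k \<omega> - t)\<^sup>2) = real k / r\<^sup>2 + (real k / r - t)\<^sup>2"
proof -
  have *: "integrable gaps (\<lambda>\<omega>. (arrival k \<omega> - t)\<^sup>2) \<and>
    gaps.expectation (\<lambda>\<omega>. (arrival k \<omega> - t)\<^sup>2) = real k / r\<^sup>2 + (real k / r - t)\<^sup>2"
  proof (cases k)
    case 0
    then show ?thesis by (simp add: gaps.prob_space)
  next
    case (Suc j)
    have int: "integrable gaps (\<lambda>\<omega>. arrival k \<omega> ^ i)"
      and moment: "gaps.expectation (\<lambda>\<omega>. arrival k \<omega> ^ i) = fact (j + i) / (fact j * r ^ i)" for i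
      using gaps.erlang_ith_moment_integrable[OF r_pos arrival_erlang]
        gaps.erlang_ith_moment[OF r_pos arrival_erlang] by (simp_all add: Suc)
    have expand: "(arrival k \<omega> - t)\<^sup>2 = arrival k \<omega> ^ 2 - (2 * t * arrival k \<omega> ^ 1 - t\<^sup>2)" for \<omega>
      by (simp add: power2_diff algebra_simps)
    have int': "integrable gaps (\<lambda>\<omega>. 2 * t * arrival k \<omega> ^ 1 - t\<^sup>2)"
      by (intro Bochner_Integration.integrable_diff integrable_mult_right int) auto
    have "gaps.expectation (\<lambda>\<omega>. (arrival k \<omega> - t)\<^sup>2)
        = gaps.expectation (\<lambda>\<omega>. arrival k \<omega> ^ 2) - (2 * t * gaps.expectation (\<lambda>\<omega>. arrival k \<omega> ^ 1) - t\<^sup>2)"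
      unfolding expand Bochner_Integration.integral_diff[OF int int']
      by (subst Bochner_Integration.integral_diff)
        (use int[of 1] in \<open>auto simp: gaps.prob_space\<close>)
    also have "\<dots> = real k * (real k + 1) / r\<^sup>2 - (2 * t * (real k / r) - t\<^sup>2)"
      unfolding moment using r_pos by (simp add: Suc fact_reduce power2_eq_square field_simps)
    also have "\<dots> = real k / r\<^sup>2 + (real k / r - t)\<^sup>2"
      using r_pos by (simp add: power2_eq_square field_simps)
    finally have "gaps.expectation (\<lambda>\<omega>. (arrival k \<omega> - t)\<^sup>2) = real k / r\<^sup>2 + (real k / r - t)\<^sup>2" .
    moreover have "integrable gaps (\<lambda>\<omega>. (arrival k \<omega> - t)\<^sup>2)"
      unfolding expand by (intro Bochner_Integration.integrable_diff int int')
    ultimately show ?thesis by simp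
  qed
  from * show "integrable gaps (\<lambda>\<omega>. (arrival k \<omega> - t)\<^sup>2)"
    and "gaps.expectation (\<lambda>\<omega>. (arrival k \<omega> - t)\<^sup>2) = real k / r\<^sup>2 + (real k / r - t)\<^sup>2"
    by auto
qed

text \<open>Young's inequality trades the first absolute moment for the second one, which is explicit; the
  weight \<open>\<delta>\<close> is chosen of order \<open>1 / sqrt r\<close> later.\<close>

lemma arrival_abs_deviation:
  assumes "0 < \<delta>"
  shows "integrable gaps (\<lambda>\<omega>. \<bar>arrival k \<omega> - t\<bar>)"
    and "gaps.expectation (\<lambda>\<omega>. \<bar>arrival k \<omega> - t\<bar>)
      \<le> \<delta> / 2 + (real k / r\<^sup>2 + (real k / r - t)\<^sup>2) / (2 * \<delta>)"
proof -
  have young: "\<bar>x\<bar> \<le> \<delta> / 2 + x\<^sup>2 / (2 * \<delta>)" for x :: real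
  proof -
    have "0 \<le> (\<bar>x\<bar> - \<delta>)\<^sup>2" by simp
    then have "2 * \<delta> * \<bar>x\<bar> \<le> \<delta>\<^sup>2 + x\<^sup>2"
      by (simp add: power2_diff algebra_simps)
    then show ?thesis
      using assms by (simp add: field_simps power2_eq_square)
  qed
  have bound: "integrable gaps (\<lambda>\<omega>. \<delta> / 2 + (arrival k \<omega> - t)\<^sup>2 / (2 * \<delta>))"
    by (intro Bochner_Integration.integrable_add integrable_divide arrival_square_deviation) auto
  show int: "integrable gaps (\<lambda>\<omega>. \<bar>arrival k \<omega> - t\<bar>)"
    by (rule Bochner_Integration.integrable_bound[OF bound])
      (use young in \<open>auto intro!: AE_I2 intro: order_trans[OF _ abs_ge_self]\<close>)
  have "gaps.expectation (\<lambda>\<omega>. \<bar>arrival k \<omega> - t\<bar>) \<le> gaps.expectation (\<lambda>\<omega>. \<delta> / 2 + (arrival k \<omega> - t)\<^sup>2 / (2 * \<delta>))"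
    by (rule integral_mono[OF int bound young])
  also have "\<dots> = \<delta> / 2 + (real k / r\<^sup>2 + (real k / r - t)\<^sup>2) / (2 * \<delta>)"
    by (subst Bochner_Integration.integral_add)
      (auto simp: gaps.prob_space arrival_square_deviation intro!: integrable_divide)
  finally show "gaps.expectation (\<lambda>\<omega>. \<bar>arrival k \<omega> - t\<bar>)
      \<le> \<delta> / 2 + (real k / r\<^sup>2 + (real k / r - t)\<^sup>2) / (2 * \<delta>)" .
qed

end

context bounded_hazard
begin

lemma hazard_abs_le: "0 \<le> t \<Longrightarrow> \<bar>h t\<bar> \<le> C"
  using hazard_le hazard_nonneg by simp

lemma hazard_integrable_Icc: "0 \<le> s \<Longrightarrow> set_integrable lborel {s..t} h"
  by (rule set_integrable_Icc_bounded) (auto intro: hazard_abs_le)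

lemma cumulative_hazard_Lipschitz:
  assumes "0 \<le> s" "0 \<le> t"
  shows "\<bar>cumulative_hazard t - cumulative_hazard s\<bar> \<le> C * \<bar>t - s\<bar>"
proof -
  have *: "\<bar>cumulative_hazard t - cumulative_hazard s\<bar> \<le> C * (t - s)" if "0 \<le> s" "s \<le> t" for s t
    using set_integral_Icc_combine[OF that hazard_integrable_Icc] that
      set_integral_Icc_bounded[of s t h C] hazard_abs_le
    by (auto simp: cumulative_hazard_def)
  show ?thesis
    using *[of s t] *[of t s] assms by (cases "s \<le> t") auto
qed

lemma cumulative_hazard_nonneg: "0 \<le> cumulative_hazard t"
  unfolding cumulative_hazard_def set_lebesgue_integral_def
  by (intro integral_nonneg_AE AE_I2) (simp add: hazard_nonneg)

text \<open>The cut-off at 0 makes the function total; it is evaluated at arrival times, which are almost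
  surely nonnegative.\<close>

lemma cumulative_hazard_measurable: "(\<lambda>t. cumulative_hazard (max 0 t)) \<in> borel_measurable borel"
proof -
  have "cumulative_hazard (max 0 t) = - ln (survival (max 0 t))" for t
    by (simp add: survival_eq_exp)
  then show ?thesis by simp
qed

lemma survival_tendsto_0: "(survival \<longlongrightarrow> 0) at_top"
  unfolding survival_def[abs_def] using tendsto_diff[OF tendsto_const cdf_lim_at_top_prob, of 1] by simp

text \<open>Without any hazard there would be no death at all.  This makes every admissible \<open>n\<close> positive.\<close>

lemma C_pos: "0 < C"
proof (rule ccontr)
  assume "\<not> 0 < C"
  then have "C = 0" using C_nonneg by simp
  then have "h t = 0" if "0 \<le> t" for t
    using hazard_abs_le[OF that] by simp
  then have "cumulative_hazard t = 0" for t
    unfolding cumulative_hazard_def set_lebesgue_integral_def by (intro integral_eq_zero_AE AE_I2) (auto split: split_indicator)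
  then have "eventually (\<lambda>t. survival t = 1) at_top"
    by (auto intro: eventually_mono[OF eventually_ge_at_top[of 0]] simp: survival_eq_exp)
  then have "(survival \<longlongrightarrow> 1) at_top"
    by (rule tendsto_eventually)
  with survival_tendsto_0 show False
    using tendsto_unique[OF trivial_limit_at_top_linorder] by fastforce
qed

end

section \<open>Distance between the Coxian law and the original law\<close>

lemma prod_one_minus_approx_exp:
  fixes q :: "nat \<Rightarrow> real"
  assumes "\<And>m. m \<in> A \<Longrightarrow> 0 \<le> q m" "\<And>m. m \<in> A \<Longrightarrow> q m \<le> K" "\<And>m. m \<in> A \<Longrightarrow> q m \<le> 1" "finite A"
  shows "\<bar>(\<Prod>m\<in>A. 1 - q m) - exp (- (\<Sum>m\<in>A. q m))\<bar> \<le> real (card A) * K\<^sup>2"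
proof -
  have "exp (- (\<Sum>m\<in>A. q m)) = (\<Prod>m\<in>A. exp (- q m))"
    using \<open>finite A\<close> by (simp add: sum_negf[symmetric] exp_sum)
  then have "\<bar>(\<Prod>m\<in>A. 1 - q m) - exp (- (\<Sum>m\<in>A. q m))\<bar> \<le> (\<Sum>m\<in>A. \<bar>(1 - q m) - exp (- q m)\<bar>)"
    using norm_prod_diff[of A "\<lambda>m. 1 - q m" "\<lambda>m. exp (- q m)"] assms by simp
  also have "\<dots> \<le> (\<Sum>m\<in>A. K\<^sup>2)"
  proof (rule sum_mono)
    fix m assume m: "m \<in> A"
    have q: "0 \<le> q m" "q m \<le> K" using assms m by auto
    have lower: "1 - q m \<le> exp (- q m)"
      using exp_ge_add_one_self[of "- q m"] by simp
    have "exp (- q m) * (1 + q m) \<le> exp (- q m) * exp (q m)"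
      using exp_ge_add_one_self[of "q m"] by (intro mult_left_mono) auto
    also have "\<dots> = 1"
      by (simp add: exp_minus)
    also have "\<dots> \<le> (1 - q m + (q m)\<^sup>2) * (1 + q m)"
      using q by (simp add: algebra_simps power2_eq_square)
    finally have "exp (- q m) \<le> 1 - q m + (q m)\<^sup>2"
      using q by (simp add: mult_le_cancel_right)
    moreover have "(q m)\<^sup>2 \<le> K\<^sup>2"
      using q by (intro power_mono) auto
    ultimately show "\<bar>(1 - q m) - exp (- q m)\<bar> \<le> K\<^sup>2"
      using lower by simp
  qed
  finally show ?thesis by simp
qed

lemma exp_minus_Lipschitz:
  fixes a b :: real
  assumes "0 \<le> a" "0 \<le> b"
  shows "\<bar>exp (- a) - exp (- b)\<bar> \<le> \<bar>a - b\<bar>"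
proof -
  have *: "exp (- a) - exp (- b) \<le> b - a" if "0 \<le> a" "a \<le> b" for a b :: real
  proof -
    have "exp (- a) - exp (- b) = exp (- a) * (1 - exp (- (b - a)))"
      by (simp add: right_diff_distrib flip: exp_add)
    also have "\<dots> \<le> 1 * (b - a)"
    proof (rule mult_mono)
      show "1 - exp (- (b - a)) \<le> b - a"
        using exp_ge_add_one_self[of "- (b - a)"] by linarith
    qed (use that in auto)
    finally show ?thesis by simp
  qed
  show ?thesis
    using *[of a b] *[of b a] assms by (cases "a \<le> b") auto
qed

locale coxian_approximation = bounded_hazard \<mu> f C
  for \<mu> :: "real measure" and f :: "real \<Rightarrow> real" and C :: real +
  fixes n :: nat
  assumes C_le: "C \<le> real n"
begin

sublocale poisson_arrivals "real n"
  using C_pos C_le by unfold_locales simp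

text \<open>The index is shifted: \<open>kill_prob m\<close> is the probability of termination at the jump number
  \<open>m + 1\<close>.\<close>

definition kill_prob :: "nat \<Rightarrow> real" where
  "kill_prob m = (LBINT s:{0..}. poisson_weight m (real n * s) * h s)"

lemma cox_Q_Suc: "cox_Q h n (Suc m) = 1 - kill_prob m"
  by (simp add: cox_Q_def kill_prob_def poisson_weight_def)

lemma kill_integrable: "set_integrable lborel {0..} (\<lambda>s. poisson_weight m (real n * s) * h s)"
  unfolding set_integrable_def
proof (rule Bochner_Integration.integrable_bound)
  show "integrable lborel (\<lambda>s. C * (indicator {0..} s * poisson_weight m (real n * s)))"
    using has_bochner_integral_poisson_weight[of m] by (intro integrable_mult_right) (simp add: has_bochner_integral_iff)
  show "AE s in lborel. norm (indicator {0..} s *\<^sub>R (poisson_weight m (real n * s) * h s))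
      \<le> norm (C * (indicator {0..} s * poisson_weight m (real n * s)))"
    using C_nonneg hazard_nonneg hazard_le
    by (intro AE_I2) (auto simp: abs_mult poisson_weight_nonneg mult.commute split: split_indicator intro!: mult_right_mono)
qed measurable

lemma kill_nonneg: "0 \<le> kill_prob m"
  unfolding kill_prob_def set_lebesgue_integral_def
  by (intro integral_nonneg_AE AE_I2) (auto simp: poisson_weight_nonneg hazard_nonneg split: split_indicator)

lemma kill_le: "kill_prob m \<le> C / n"
proof -
  have "kill_prob m \<le> (LBINT s. C * (indicator {0..} s * poisson_weight m (real n * s)))"
    unfolding kill_prob_def set_lebesgue_integral_def
  proof (rule integral_mono)
    show "integrable lborel (\<lambda>s. indicator {0..} s *\<^sub>R (poisson_weight m (real n * s) * h s))"
      using kill_integrable[of m] by (simp add: set_integrable_def)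
    show "integrable lborel (\<lambda>s. C * (indicator {0..} s * poisson_weight m (real n * s)))"
      using has_bochner_integral_poisson_weight[of m] by (intro integrable_mult_right) (simp add: has_bochner_integral_iff)
    show "indicator {0..} s *\<^sub>R (poisson_weight m (real n * s) * h s) \<le> C * (indicator {0..} s * poisson_weight m (real n * s))" for s
      using hazard_le[of s] by (auto simp: poisson_weight_nonneg mult.commute split: split_indicator intro!: mult_right_mono)
  qed
  also have "\<dots> = C / n"
    using has_bochner_integral_integral_eq[OF has_bochner_integral_poisson_weight[of m]] by simp
  finally show ?thesis .
qed

lemma kill_le_1: "kill_prob m \<le> 1"
  using kill_le[of m] C_le r_pos by (simp add: divide_le_eq order_trans)

text \<open>The mean of \<open>H A_k\<close> is, by Fubini's theorem, the integral of the hazard rate against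
  the probability that \<open>A_k\<close> exceeds \<open>s\<close>, and that probability is the sum of the first \<open>k\<close> Poisson weights.\<close>

lemma expected_cumulative_hazard:
  "has_bochner_integral gaps (\<lambda>\<omega>. cumulative_hazard (max 0 (arrival k \<omega>))) (\<Sum>m<k. kill_prob m)"
proof (rule has_bochner_integral_nn_integral)
  show "(\<lambda>\<omega>. cumulative_hazard (max 0 (arrival k \<omega>))) \<in> borel_measurable gaps"
    by (rule measurable_compose[OF arrival_measurable cumulative_hazard_measurable])
  interpret pair_sigma_finite gaps lborel ..
  let ?g = "\<lambda>\<omega> s. ennreal (indicator {0..} s * h s) * indicator {s<..} (arrival k \<omega>)"
  have "(\<integral>\<^sup>+\<omega>. ennreal (cumulative_hazard (max 0 (arrival k \<omega>))) \<partial>gaps) = (\<integral>\<^sup>+\<omega>. (\<integral>\<^sup>+s. ?g \<omega> s \<partial>lborel) \<partial>gaps)"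
  proof (rule nn_integral_cong)
    fix \<omega>
    let ?a = "arrival k \<omega>"
    have "integrable lborel (\<lambda>s. indicator {0..max 0 ?a} s * h s)"
      using hazard_integrable_Icc[of 0 "max 0 ?a"] by (simp add: set_integrable_def)
    then have "ennreal (cumulative_hazard (max 0 ?a)) = (\<integral>\<^sup>+s. ennreal (indicator {0..max 0 ?a} s * h s) \<partial>lborel)"
      unfolding cumulative_hazard_def set_lebesgue_integral_def
      by (subst nn_integral_eq_integral) (auto simp: hazard_nonneg)
    also have "\<dots> = (\<integral>\<^sup>+s. ?g \<omega> s \<partial>lborel)"
      by (rule nn_integral_cong_AE)
        (use AE_lborel_singleton[of "max 0 ?a"] in \<open>eventually_elim, auto split: split_indicator\<close>)
    finally show "ennreal (cumulative_hazard (max 0 ?a)) = (\<integral>\<^sup>+s. ?g \<omega> s \<partial>lborel)" .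
  qed
  also have "\<dots> = (\<integral>\<^sup>+s. (\<integral>\<^sup>+\<omega>. ?g \<omega> s \<partial>gaps) \<partial>lborel)"
  proof (rule Fubini'[symmetric])
    have [measurable]: "(\<lambda>p. arrival k (fst p)) \<in> borel_measurable (gaps \<Otimes>\<^sub>M lborel)"
      by measurable
    have "(\<lambda>p. ennreal (indicator {0..} (snd p) * h (snd p)) * (if snd p < arrival k (fst p) then 1 else 0)) \<in> borel_measurable (gaps \<Otimes>\<^sub>M lborel)"
      by measurable
    then show "(\<lambda>(\<omega>, s). ?g \<omega> s) \<in> borel_measurable (gaps \<Otimes>\<^sub>M lborel)"
      by (simp add: indicator_def case_prod_beta' of_bool_def)
  qed
  also have "\<dots> = (\<integral>\<^sup>+s. ennreal (\<Sum>m<k. indicator {0..} s * (poisson_weight m (real n * s) * h s)) \<partial>lborel)"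
  proof (rule nn_integral_cong)
    fix s :: real
    have "(\<integral>\<^sup>+\<omega>. ?g \<omega> s \<partial>gaps)
        = (\<integral>\<^sup>+\<omega>. ennreal (indicator {0..} s * h s) * indicator {\<omega> \<in> space gaps. s < arrival k \<omega>} \<omega> \<partial>gaps)"
      by (rule nn_integral_cong) (simp add: indicator_def)
    also have "\<dots> = ennreal (indicator {0..} s * h s) * emeasure gaps {\<omega> \<in> space gaps. s < arrival k \<omega>}"
      by (rule nn_integral_cmult_indicator) measurable
    also have "\<dots> = ennreal (\<Sum>m<k. indicator {0..} s * (poisson_weight m (real n * s) * h s))"
      using hazard_nonneg[of s]
      by (cases "0 \<le> s")
        (auto simp: gaps.emeasure_eq_measure prob_arrival_gt ennreal_mult'[symmetric] sum_distrib_left mult.commute)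
    finally show "(\<integral>\<^sup>+\<omega>. ?g \<omega> s \<partial>gaps) = ennreal (\<Sum>m<k. indicator {0..} s * (poisson_weight m (real n * s) * h s))" .
  qed
  also have "\<dots> = ennreal (LBINT s. (\<Sum>m<k. indicator {0..} s * (poisson_weight m (real n * s) * h s)))"
    using kill_integrable
    by (intro nn_integral_eq_integral Bochner_Integration.integrable_sum AE_I2 sum_nonneg)
      (auto simp: set_integrable_def poisson_weight_nonneg hazard_nonneg split: split_indicator)
  also have "(LBINT s. (\<Sum>m<k. indicator {0..} s * (poisson_weight m (real n * s) * h s))) = (\<Sum>m<k. kill_prob m)"
    using kill_integrable
    by (subst Bochner_Integration.integral_sum) (auto simp: set_integrable_def kill_prob_def set_lebesgue_integral_def)
  finally show "(\<integral>\<^sup>+\<omega>. ennreal (cumulative_hazard (max 0 (arrival k \<omega>))) \<partial>gaps) = ennreal (\<Sum>m<k. kill_prob m)" .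
qed (auto simp: cumulative_hazard_nonneg sum_nonneg kill_nonneg)

text \<open>\<open>H\<close> is Lipschitz with constant \<open>C\<close>, so \<open>H A_k\<close> is close to \<open>H t\<close> if \<open>A_k\<close> is close to \<open>t\<close>.\<close>

lemma sum_kill_approx:
  assumes "0 \<le> t" "0 < \<delta>"
  shows "\<bar>(\<Sum>m<k. kill_prob m) - cumulative_hazard t\<bar>
    \<le> C * (\<delta> / 2 + (real k / (real n)\<^sup>2 + (real k / n - t)\<^sup>2) / (2 * \<delta>))"
proof -
  let ?H = "\<lambda>\<omega>. cumulative_hazard (max 0 (arrival k \<omega>))"
  note E = expected_cumulative_hazard[of k, unfolded has_bochner_integral_iff]
  have "(\<Sum>m<k. kill_prob m) - cumulative_hazard t = gaps.expectation (\<lambda>\<omega>. ?H \<omega> - cumulative_hazard t)"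
    using E by (simp add: gaps.prob_space)
  also have "\<bar>\<dots>\<bar> \<le> gaps.expectation (\<lambda>\<omega>. \<bar>?H \<omega> - cumulative_hazard t\<bar>)"
    by (rule integral_abs_bound)
  also have "\<dots> \<le> gaps.expectation (\<lambda>\<omega>. C * \<bar>arrival k \<omega> - t\<bar>)"
  proof (rule integral_mono)
    show "integrable gaps (\<lambda>\<omega>. \<bar>?H \<omega> - cumulative_hazard t\<bar>)"
      using E by (intro integrable_abs Bochner_Integration.integrable_diff) auto
    show "integrable gaps (\<lambda>\<omega>. C * \<bar>arrival k \<omega> - t\<bar>)"
      by (intro integrable_mult_right arrival_abs_deviation(1)[OF \<open>0 < \<delta>\<close>])
    fix \<omega>
    have "\<bar>?H \<omega> - cumulative_hazard t\<bar> \<le> C * \<bar>max 0 (arrival k \<omega>) - t\<bar>"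
      using assms by (intro cumulative_hazard_Lipschitz) auto
    also have "\<dots> \<le> C * \<bar>arrival k \<omega> - t\<bar>"
      using assms C_nonneg by (intro mult_left_mono) auto
    finally show "\<bar>?H \<omega> - cumulative_hazard t\<bar> \<le> C * \<bar>arrival k \<omega> - t\<bar>" .
  qed
  also have "\<dots> \<le> C * (\<delta> / 2 + (real k / (real n)\<^sup>2 + (real k / n - t)\<^sup>2) / (2 * \<delta>))"
    using arrival_abs_deviation(2)[OF \<open>0 < \<delta>\<close>] C_nonneg by (simp add: mult_left_mono)
  finally show ?thesis .
qed

lemma prod_cox_Q: "(\<Prod>m=1..k. cox_Q h n m) = (\<Prod>m<k. 1 - kill_prob m)"
proof -
  have "(\<Prod>m=1..k. cox_Q h n m) = (\<Prod>m<k. cox_Q h n (Suc m))"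
    by (rule prod.reindex_bij_witness[of _ Suc "\<lambda>m. m - 1"]) auto
  then show ?thesis by (simp add: cox_Q_Suc)
qed

lemma prod_cox_Q_approx: "\<bar>(\<Prod>m=1..k. cox_Q h n m) - exp (- (\<Sum>m<k. kill_prob m))\<bar> \<le> real k * (C / n)\<^sup>2"
  unfolding prod_cox_Q
  using prod_one_minus_approx_exp[of "{..<k}" kill_prob "C / n"] kill_nonneg kill_le kill_le_1 by simp

text \<open>A lower bound for \<open>E (H A_k)\<close> that only counts the outcomes with \<open>t < A_k\<close>.\<close>

lemma sum_kill_ge:
  assumes "0 \<le> t"
  shows "(\<Sum>m<k. poisson_weight m (real n * t)) * cumulative_hazard t \<le> (\<Sum>m<k. kill_prob m)"
proof -
  note E = expected_cumulative_hazard[of k, unfolded has_bochner_integral_iff]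
  have "(\<Sum>m<k. poisson_weight m (real n * t)) * cumulative_hazard t
      = gaps.expectation (\<lambda>\<omega>. indicator {\<omega>. t < arrival k \<omega>} \<omega> * cumulative_hazard t)"
    using assms by (simp add: prob_arrival_gt)
  also have "\<dots> \<le> gaps.expectation (\<lambda>\<omega>. cumulative_hazard (max 0 (arrival k \<omega>)))"
  proof (rule integral_mono)
    have "{\<omega> \<in> space gaps. t < arrival k \<omega>} \<in> sets gaps" by measurable
    then show "integrable gaps (\<lambda>\<omega>. indicator {\<omega>. t < arrival k \<omega>} \<omega> * cumulative_hazard t)"
      by (intro integrable_mult_left integrable_real_indicator) (simp_all add: gaps.emeasure_eq_measure)
    have mono: "cumulative_hazard t \<le> cumulative_hazard u" if "t \<le> u" for u
      using survival_antimono[OF that] survival_eq_exp[of t] survival_eq_exp[of u] assms that by simp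
    show "indicator {\<omega>. t < arrival k \<omega>} \<omega> * cumulative_hazard t \<le> cumulative_hazard (max 0 (arrival k \<omega>))" for \<omega>
      using mono[of "max 0 (arrival k \<omega>)"] cumulative_hazard_nonneg by (auto split: split_indicator)
  qed (use E in simp)
  finally show ?thesis using E by simp
qed

text \<open>Letting \<open>k\<close> tend to infinity in \<open>sum_kill_ge\<close> shows that the limit superior of the products is at
  most \<open>exp (- H t)\<close>, the survival function at \<open>t\<close>; and this becomes small for large \<open>t\<close>.\<close>

lemma prod_cox_Q_tendsto_0: "(\<lambda>k. \<Prod>m=1..k. cox_Q h n m) \<longlonglongrightarrow> 0"
proof (rule LIMSEQ_I)
  fix \<epsilon> :: real assume "0 < \<epsilon>"
  have "eventually (\<lambda>t. survival t < \<epsilon>) at_top"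
    using order_tendstoD(2)[OF survival_tendsto_0 \<open>0 < \<epsilon>\<close>] .
  then obtain t where t: "0 \<le> t" "survival t < \<epsilon>"
    using eventually_conj[OF _ eventually_ge_at_top[of 0]] by (metis (mono_tags, lifting) eventually_at_top_linorder order_refl)
  have "(\<lambda>k. exp (- ((\<Sum>m<k. poisson_weight m (real n * t)) * cumulative_hazard t)))
      \<longlonglongrightarrow> exp (- (1 * cumulative_hazard t))"
    using poisson_weight_sums[of "real n * t"] unfolding sums_def by (intro tendsto_intros)
  moreover have "exp (- (1 * cumulative_hazard t)) < \<epsilon>"
    using t survival_eq_exp[of t] by simp
  ultimately have "\<forall>\<^sub>F k in sequentially. exp (- ((\<Sum>m<k. poisson_weight m (real n * t)) * cumulative_hazard t)) < \<epsilon>"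
    by (rule order_tendstoD(2))
  then obtain k0 where k0: "\<And>k. k0 \<le> k \<Longrightarrow> exp (- ((\<Sum>m<k. poisson_weight m (real n * t)) * cumulative_hazard t)) < \<epsilon>"
    by (auto simp: eventually_sequentially)
  have "norm ((\<Prod>m=1..k. cox_Q h n m) - 0) < \<epsilon>" if "k0 \<le> k" for k
  proof -
    have "(\<Prod>m<k. 1 - kill_prob m) \<le> (\<Prod>m<k. exp (- kill_prob m))"
      using kill_le_1 exp_ge_add_one_self[of "- kill_prob _"] by (intro prod_mono) auto
    also have "\<dots> = exp (- (\<Sum>m<k. kill_prob m))"
      by (simp add: exp_sum[symmetric] sum_negf)
    also have "\<dots> \<le> exp (- ((\<Sum>m<k. poisson_weight m (real n * t)) * cumulative_hazard t))"
      using sum_kill_ge[OF t(1), of k] by simp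
    also have "\<dots> < \<epsilon>" by (rule k0[OF that])
    moreover have "0 \<le> (\<Prod>m<k. 1 - kill_prob m)"
      using kill_le_1 by (intro prod_nonneg) simp
    ultimately show ?thesis unfolding prod_cox_Q by simp
  qed
  then show "\<exists>k0. \<forall>k\<ge>k0. norm ((\<Prod>m=1..k. cox_Q h n m) - 0) < \<epsilon>" by blast
qed

sublocale coxian "real n" "cox_Q h n"
proof
  have "cox_Q h n l = 1 - kill_prob (l - 1)" for l
    using cox_Q_Suc[of "l - 1"] by (cases l) (simp_all add: cox_Q_def)
  then show "0 \<le> cox_Q h n l" "cox_Q h n l \<le> 1" for l
    using kill_nonneg kill_le_1 by auto
qed (rule prod_cox_Q_tendsto_0)

text \<open>For \<open>k\<close> arrivals up to time \<open>t\<close>, the error is bounded by a quadratic polynomial in \<open>k\<close>, whose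
  Poisson average is explicit: both \<open>A_k\<close> around \<open>k / n\<close> and \<open>k / n\<close> around \<open>t\<close> contribute the variance
  \<open>t / n\<close>.\<close>

lemma cdf_law_approx:
  assumes "0 \<le> t"
  shows "\<bar>cdf law t - cdf \<mu> t\<bar> \<le> C\<^sup>2 * t / n + C * (1 / 2 + t) / sqrt n"
proof -
  \<comment> \<open>balances the two terms of the bound in \<open>arrival_abs_deviation\<close>\<close>
  define \<delta> where "\<delta> = 1 / sqrt n"
  have n: "0 < real n" by (rule r_pos)
  then have \<delta>: "0 < \<delta>" by (simp add: \<delta>_def)
  define \<beta> where "\<beta> = C / (2 * \<delta>)"
  define e where "e k = (C * \<delta> / 2 + \<beta> * t\<^sup>2) + ((C / n)\<^sup>2 + \<beta> / (real n)\<^sup>2 - 2 * \<beta> * t / n) * real k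
    + (\<beta> / (real n)\<^sup>2) * (real k)\<^sup>2" for k
  have "\<bar>reach 0 k - survival t\<bar> \<le> e k" for k
  proof -
    have "\<bar>reach 0 k - survival t\<bar>
        \<le> \<bar>reach 0 k - exp (- (\<Sum>m<k. kill_prob m))\<bar> + \<bar>exp (- (\<Sum>m<k. kill_prob m)) - exp (- cumulative_hazard t)\<bar>"
      using survival_eq_exp[OF assms] by simp
    also have "\<bar>reach 0 k - exp (- (\<Sum>m<k. kill_prob m))\<bar> \<le> real k * (C / n)\<^sup>2"
      using prod_cox_Q_approx[of k] by (simp add: reach_def)
    also have "\<bar>exp (- (\<Sum>m<k. kill_prob m)) - exp (- cumulative_hazard t)\<bar> \<le> \<bar>(\<Sum>m<k. kill_prob m) - cumulative_hazard t\<bar>"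
      by (intro exp_minus_Lipschitz sum_nonneg kill_nonneg cumulative_hazard_nonneg)
    also have "\<dots> \<le> C * (\<delta> / 2 + (real k / (real n)\<^sup>2 + (real k / n - t)\<^sup>2) / (2 * \<delta>))"
      by (rule sum_kill_approx[OF assms \<delta>])
    also have "real k * (C / n)\<^sup>2 + C * (\<delta> / 2 + (real k / (real n)\<^sup>2 + (real k / n - t)\<^sup>2) / (2 * \<delta>)) = e k"
    proof -
      have "C * (\<delta> / 2 + (real k / (real n)\<^sup>2 + (real k / n - t)\<^sup>2) / (2 * \<delta>))
          = C * \<delta> / 2 + \<beta> * (real k / (real n)\<^sup>2 + (real k / n - t)\<^sup>2)"
        by (simp add: \<beta>_def algebra_simps add_divide_distrib)
      then show ?thesis
        by (simp add: e_def power2_eq_square algebra_simps)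
    qed
    finally show ?thesis by simp
  qed
  moreover have "(\<lambda>k. poisson_weight k (real n * t) * e k) sums
      ((C * \<delta> / 2 + \<beta> * t\<^sup>2) * 1 + ((C / n)\<^sup>2 + \<beta> / (real n)\<^sup>2 - 2 * \<beta> * t / n) * (real n * t)
        + (\<beta> / (real n)\<^sup>2) * ((real n * t)\<^sup>2 + real n * t))" (is "_ sums ?s")
  proof -
    have "(\<lambda>k. (C * \<delta> / 2 + \<beta> * t\<^sup>2) * poisson_weight k (real n * t)
        + ((C / n)\<^sup>2 + \<beta> / (real n)\<^sup>2 - 2 * \<beta> * t / n) * (real k * poisson_weight k (real n * t))
        + (\<beta> / (real n)\<^sup>2) * ((real k)\<^sup>2 * poisson_weight k (real n * t))) sums ?s"
      by (intro sums_add sums_mult poisson_weight_sums poisson_mean_sums poisson_second_moment_sums)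
    then show ?thesis by (simp add: e_def algebra_simps)
  qed
  ultimately have "\<bar>poisson_average (reach 0) (real n * t) - survival t\<bar> \<le> ?s"
    using assms n by (intro poisson_average_dist_le[OF abs_reach]) auto
  also have "?s = C\<^sup>2 * t / n + (C * \<delta> / 2 + 2 * \<beta> * t / n)"
    using n by (simp add: field_simps power2_eq_square)
  also have "C * \<delta> / 2 + 2 * \<beta> * t / n = C * (1 / 2 + t) / sqrt n"
  proof -
    have "2 * \<beta> * t / n = C * t * (sqrt n / n)"
      by (simp add: \<beta>_def \<delta>_def)
    also have "sqrt n / n = 1 / sqrt n"
      by (simp add: sqrt_divide_self_eq inverse_eq_divide)
    finally have "2 * \<beta> * t / n = C * t / sqrt n"
      by simp
    then show ?thesis by (simp add: \<delta>_def add_divide_distrib distrib_left)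
  qed
  finally show ?thesis
    using assms by (simp add: cdf_law survival_def)
qed

end

section \<open>Weak convergence\<close>

lemma distributed_imp_bounded_hazard:
  fixes M :: "'a measure" and Y :: "'a \<Rightarrow> real" and f :: "real \<Rightarrow> real"
  assumes "prob_space M" "AE \<omega> in M. 0 \<le> Y \<omega>" "\<And>x. 0 \<le> f x"
    and Y: "distributed M lborel Y (\<lambda>x. ennreal (f x))"
    and bounded: "bounded (hazard_rate (distr M borel Y) f ` {0..})"
  shows "bounded_hazard (distr M borel Y) f (SUP t\<in>{0..}. hazard_rate (distr M borel Y) f t)"
proof -
  interpret prob_space M by fact
  have Y_meas: "Y \<in> borel_measurable M"
    using distributed_measurable[OF Y] by simp
  show ?thesis
  proof (intro bounded_hazard.intro bounded_hazard_axioms.intro)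
    show "real_distribution (distr M borel Y)"
      using Y_meas by (rule real_distribution_distr)
    show "0 \<le> f x" for x by fact
    have "(\<lambda>x. enn2real (ennreal (f x))) \<in> borel_measurable borel"
      using distributed_borel_measurable[OF Y] by measurable
    then show "f \<in> borel_measurable borel"
      using assms(3) by simp
    have "distr M borel Y = distr M lborel Y"
      by (rule distr_cong) auto
    then show "distr M borel Y = density lborel (\<lambda>x. ennreal (f x))"
      using distributed_distr_eq_density[OF Y] by simp
    show "AE x in distr M borel Y. 0 \<le> x"
      using assms(2) Y_meas by (subst AE_distr_iff) auto
    show "hazard_rate (distr M borel Y) f t \<le> (SUP t\<in>{0..}. hazard_rate (distr M borel Y) f t)" if "0 \<le> t" for t
      using that by (intro cSUP_upper bounded_imp_bdd_above bounded) auto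
  qed
qed

context coxian_approximation
begin

lemma infinite_phase_type_cox_S: "infinite_phase_type (\<lambda>i. if i = 0 then 1 else 0) (cox_S h n) law"
proof -
  have "rates = cox_S h n"
    by (simp add: fun_eq_iff rates_def cox_S_def)
  then show ?thesis
    using infinite_phase_type_law by simp
qed

lemma law_eq_cox_density: "law = density lborel (\<lambda>y. ennreal (if 0 \<le> y then cox_density h n y else 0))"
proof -
  have "coxian_density = cox_density h n"
    by (simp add: fun_eq_iff coxian_density_def cox_density_def)
  then show ?thesis
    by (rule subst[where P = "\<lambda>g. law = density lborel (\<lambda>y. ennreal (if 0 \<le> y then g y else 0))",
          OF _ law_eq_density])
qed

end

context bounded_hazard
begin

text \<open>Only the terms with \<open>C \<le> n\<close> are prescribed, as the others do not affect the limit.\<close>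

lemma coxian_laws_weakly_converge:
  assumes L: "\<And>n. C \<le> real n \<Longrightarrow> L n = coxian.law (real n) (cox_Q h n)"
  shows "weak_conv_m L \<mu>"
  unfolding weak_conv_m_def weak_conv_def
proof (intro allI impI)
  fix x
  have large: "\<forall>\<^sub>F n in sequentially. C \<le> real n"
    using eventually_ge_at_top[of "nat \<lceil>C\<rceil>"] by eventually_elim linarith
  have approx: "coxian_approximation \<mu> f C n" if "C \<le> real n" for n
    using that by unfold_locales
  show "(\<lambda>n. cdf (L n) x) \<longlonglongrightarrow> cdf \<mu> x"
  proof (cases "0 \<le> x")
    case True
    have "\<forall>\<^sub>F n in sequentially. norm (cdf (L n) x - cdf \<mu> x) \<le> C\<^sup>2 * x / n + C * (1 / 2 + x) / sqrt n"
      using large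
    proof eventually_elim
      fix n assume "C \<le> real n"
      then show "norm (cdf (L n) x - cdf \<mu> x) \<le> C\<^sup>2 * x / n + C * (1 / 2 + x) / sqrt n"
        using coxian_approximation.cdf_law_approx[OF approx True] L by simp
    qed
    moreover have "(\<lambda>n. C\<^sup>2 * x / real n + C * (1 / 2 + x) / sqrt (real n)) \<longlonglongrightarrow> 0"
      by real_asymp
    ultimately have "(\<lambda>n. cdf (L n) x - cdf \<mu> x) \<longlonglongrightarrow> 0"
      by (rule Lim_null_comparison)
    then show ?thesis
      by (rule LIM_zero_cancel)
  next
    case False
    have "cdf (L n) x = cdf \<mu> x" if n: "C \<le> real n" for n
    proof -
      interpret coxian_approximation \<mu> f C n by (rule approx[OF n])
      have "finite_borel_measure law"
        by (rule real_distribution.finite_borel_measure_M[OF real_distribution_law])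
      then have "cdf law x \<le> cdf law 0" "0 \<le> cdf law x"
        using False finite_borel_measure.cdf_nondecreasing[of law x 0] finite_borel_measure.cdf_nonneg[of law x]
        by auto
      then have "cdf law x = 0"
        by (simp add: cdf_law poisson_average_at_0)
      then show ?thesis
        using survival_negative[of x] False L[OF n] by (simp add: survival_def)
    qed
    then show ?thesis
      using large by (intro tendsto_eventually) (auto elim: eventually_mono)
  qed
qed

end

theorem corollary2:
  fixes M :: "'a measure" and Y :: "'a \<Rightarrow> real" and f h :: "real \<Rightarrow> real" and lambda0 :: nat
  assumes "prob_space M"
    and "AE \<omega> in M. 0 \<le> Y \<omega>"
    and "\<And>x. 0 \<le> f x"
    and "distributed M lborel Y (\<lambda>x. ennreal (f x))"
    and "h = hazard_rate (distr M borel Y) f"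
    and "bounded (h ` {0..})"
    and "lambda0 = nat \<lceil>SUP t\<in>{0..}. h t\<rceil>"
  shows "IPH (\<lambda>i::unit. 1) (\<lambda>i j. -1) h (distr M borel Y) \<and>
    (\<exists>(N :: (nat \<Rightarrow> real) measure) (Yn :: nat \<Rightarrow> (nat \<Rightarrow> real) \<Rightarrow> real).
       prob_space N \<and>
       (\<forall>n\<ge>lambda0. Yn n \<in> borel_measurable N) \<and>
       weak_conv_m (\<lambda>n. distr N borel (Yn n)) (distr M borel Y) \<and>
       (\<forall>n\<ge>lambda0.
          infinite_phase_type (\<lambda>i. if i = 0 then 1 else 0) (cox_S h n) (distr N borel (Yn n)) \<and>
          distributed N lborel (Yn n) (\<lambda>y. ennreal (if 0 \<le> y then cox_density h n y else 0))))"
proof -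
  let ?\<mu> = "distr M borel Y"
  define C where "C = (SUP t\<in>{0..}. h t)"
  interpret bounded_hazard ?\<mu> f C
    using distributed_imp_bounded_hazard[OF assms(1-4)] assms(6) unfolding C_def assms(5) by simp
  have C_le: "C \<le> real n \<longleftrightarrow> lambda0 \<le> n" for n
    unfolding assms(7) C_def[symmetric] by linarith
  have approx: "coxian_approximation ?\<mu> f C n" if "lambda0 \<le> n" for n
    using that C_le by unfold_locales simp
  \<comment> \<open>below \<open>lambda0\<close> any law will do; a probability law is needed for the product measure\<close>
  define L where "L n = (if lambda0 \<le> n then coxian.law (real n) (cox_Q h n) else ?\<mu>)" for n
  have Coxian: "real_distribution (L n)"
    "infinite_phase_type (\<lambda>i. if i = 0 then 1 else 0) (cox_S h n) (L n)"
    "L n = density lborel (\<lambda>y. ennreal (if 0 \<le> y then cox_density h n y else 0))"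
    if n: "lambda0 \<le> n" for n
  proof -
    interpret A: coxian_approximation ?\<mu> f C n
      by (rule approx[OF n])
    have "L n = A.law"
      using n by (simp add: L_def assms(5))
    then show "real_distribution (L n)"
      "infinite_phase_type (\<lambda>i. if i = 0 then 1 else 0) (cox_S h n) (L n)"
      "L n = density lborel (\<lambda>y. ennreal (if 0 \<le> y then cox_density h n y else 0))"
      using A.real_distribution_law A.infinite_phase_type_cox_S A.law_eq_cox_density
      unfolding assms(5) by simp_all
  qed
  have "real_distribution (L n)" for n
    using Coxian(1)[of n] real_distribution_axioms by (cases "lambda0 \<le> n") (simp_all add: L_def)
  then have sets_L: "sets (L n) = sets borel" and prob_L: "prob_space (L n)" for n
    by (simp_all add: real_distribution_def real_distribution_axioms_def)
  define N where "N = PiM UNIV L"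
  have coordinate: "(\<lambda>\<omega>. \<omega> n) \<in> borel_measurable N" for n
    using measurable_component_singleton[of n UNIV L, OF UNIV_I]
    by (simp add: N_def measurable_cong_sets[OF refl sets_L])
  have law: "distr N K (\<lambda>\<omega>. \<omega> n) = L n" if "sets K = sets borel" for n and K :: "real measure"
  proof -
    have "distr N K (\<lambda>\<omega>. \<omega> n) = distr N (L n) (\<lambda>\<omega>. \<omega> n)"
      using that by (intro distr_cong) (simp_all add: sets_L)
    also have "\<dots> = L n"
      unfolding N_def by (rule distr_PiM_component[OF prob_L UNIV_I])
    finally show ?thesis .
  qed
  have "distributed N lborel (\<lambda>\<omega>. \<omega> n) (\<lambda>y. ennreal (if 0 \<le> y then cox_density h n y else 0))"
    if "lambda0 \<le> n" for n
  proof -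
    have [measurable]: "cox_density h n \<in> borel_measurable borel"
      unfolding cox_density_def[abs_def] by measurable
    have "(\<lambda>y. ennreal (if 0 \<le> y then cox_density h n y else 0)) \<in> borel_measurable lborel"
      by measurable
    then show ?thesis
      using law[of lborel n] Coxian(3)[OF that] coordinate[of n] by (simp add: distributed_def)
  qed
  moreover have "weak_conv_m L ?\<mu>"
    using C_le by (intro coxian_laws_weakly_converge) (simp add: L_def assms(5))
  moreover have "prob_space N"
    unfolding N_def by (intro prob_space_PiM prob_L)
  moreover have "IPH (\<lambda>i::unit. 1) (\<lambda>i j. -1) h ?\<mu>"
    unfolding assms(5) by (rule IPH_hazard)
  ultimately show ?thesis
    using coordinate Coxian(2)
    by (intro conjI exI[of _ N] exI[of _ "\<lambda>n \<omega>. \<omega> n"]) (auto simp: law)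
qed

end
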